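(* Let $d\ge1$ and $1\le p\le2$. Then the Fourier transform $\mathcal{F}\colon L^p(\mathbb{R}^d)\to\dot B^{p',p}_0(\mathbb{R}^d)\cap B^{p',p}_0(\mathbb{R}^d)$ is bounded, i.e. there is a constant $C>0$ such that for every $f\in L^p(\mathbb{R}^d)$ one has $\hat f\in B^{p',p}_0$, $[\hat f]\in\dot B^{p',p}_0$, and $\|\hat f\|_{\dot B^{p',p}_0}+\|\hat f\|_{B^{p',p}_0}\le C\|f\|_{L^p}$.
   Context: $p'$ is the conjugate exponent, $1/p+1/p'=1$ (so $p'=\infty$ when $p=1$). $\mathcal{S}$ is the Schwartz space on $\mathbb{R}^d$, $\mathcal{S}'$ the tempered distributions, $\mathcal{P}$ the space of polynomials; $[f]$ denotes the class of $f\in\mathcal{S}'$ in $\mathcal{S}'/\mathcal{P}$. The Fourier transform is $\hat f(\xi)=\mathcal{F}f(\xi)=\int_{\mathbb{R}^d}f(x)e^{-2\pi i x\cdot\xi}\,dx$ on $\mathcal{S}$, extended to $\mathcal{S}'$ by $\langle\hat f,g\rangle=\langle f,\hat g\rangle$. Fix $\varphi\in\mathcal{S}$ with $\hat\varphi$ radially decreasing, $\hat\varphi(\xi)=1$ for $|\xi|\le1$, $\hat\varphi(\xi)=0$ for $|\xi|\ge2$. Define $\varphi_k$, $k\in\mathbb{Z}$, by $\hat\varphi_0(\xi)=\hat\varphi(\xi/2)-\hat\varphi(\xi)$ and $\hat\varphi_k(\xi)=\hat\varphi_0(2^{-k}\xi)$. For $1\le a\le\infty$, $1\le b<\infty$,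 $s\in\mathbb{R}$, the Besov norms are $$\|f\|_{B^{a,b}_s}=\left(\|\varphi*f\|_{L^a}^b+\sum_{k=0}^\infty2^{ksb}\|\varphi_k*f\|_{L^a}^b\right)^{1/b},\qquad\|f\|_{\dot B^{a,b}_s}=\left(\sum_{k=-\infty}^\infty2^{ksb}\|\varphi_k*f\|_{L^a}^b\right)^{1/b},$$ and $B^{a,b}_s=\{f\in\mathcal{S}':\|f\|_{B^{a,b}_s}<\infty\}$, $\dot B^{a,b}_s=\{[f]\in\mathcal{S}'/\mathcal{P}:\|f\|_{\dot B^{a,b}_s}<\infty\}$. *)

theory Defs
  imports "HOL-Analysis.Analysis" "HOL-Probability.Essential_Supremum"
begin

section \<open>Schwartz functions and tempered distributions\<close>

text \<open>Iterated partial derivatives are indexed by lists of coordinate directions instead of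
  multi-indices; a multi-index corresponds to the lists in which each direction occurs with the
  prescribed multiplicity.\<close>

primrec iter_pd :: "'a::euclidean_space list \<Rightarrow> ('a \<Rightarrow> complex) \<Rightarrow> 'a \<Rightarrow> complex" where
  "iter_pd [] f = f"
| "iter_pd (b # bs) f = (\<lambda>x. frechet_derivative (iter_pd bs f) (at x) b)"

definition schwartz :: "('a::euclidean_space \<Rightarrow> complex) \<Rightarrow> bool" where
  "schwartz f \<longleftrightarrow>
     (\<forall>bs\<in>lists Basis. iter_pd bs f differentiable_on UNIV) \<and>
     (\<forall>m. \<forall>bs\<in>lists Basis. bounded (range (\<lambda>x. (1 + norm x) ^ m * cmod (iter_pd bs f x))))"

definition schwartz_norm :: "nat \<Rightarrow> ('a::euclidean_space \<Rightarrow> complex) \<Rightarrow> real" where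
  "schwartz_norm m f =
     (SUP (x, bs) \<in> UNIV \<times> {bs \<in> lists Basis. length bs \<le> m}.
        (1 + norm x) ^ m * cmod (iter_pd bs f x))"

text \<open>A tempered distribution is a functional whose values are only relevant on Schwartz
  functions. The seminorms \<^const>\<open>schwartz_norm\<close> increase with the order and generate the Schwartz
  topology, so continuity of a linear functional is a bound by a single one of them.\<close>

definition tempered :: "(('a::euclidean_space \<Rightarrow> complex) \<Rightarrow> complex) \<Rightarrow> bool" where
  "tempered u \<longleftrightarrow>
     (\<forall>g h. schwartz g \<longrightarrow> schwartz h \<longrightarrow> u (\<lambda>x. g x + h x) = u g + u h) \<and>
     (\<forall>c g. schwartz g \<longrightarrow> u (\<lambda>x. c * g x) = c * u g) \<and>
     (\<exists>C m. \<forall>g. schwartz g \<longrightarrow> cmod (u g) \<le> C * schwartz_norm m g)"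

definition dist_of_fun :: "('a::euclidean_space \<Rightarrow> complex) \<Rightarrow> ('a \<Rightarrow> complex) \<Rightarrow> complex" where
  "dist_of_fun f = (\<lambda>g. LINT x|lebesgue. f x * g x)"

text \<open>The class of \<open>u\<close> modulo polynomials. Since distributions are compared on Schwartz functions
  only, the class also identifies functionals that agree there.\<close>

definition poly_class ::
    "(('a::euclidean_space \<Rightarrow> complex) \<Rightarrow> complex) \<Rightarrow> (('a \<Rightarrow> complex) \<Rightarrow> complex) set" where
  "poly_class u =
     {v. tempered v \<and>
         (\<exists>P. polynomial_function P \<and> (\<forall>g. schwartz g \<longrightarrow> v g = u g + dist_of_fun P g))}"

section \<open>Fourier transform and convolution\<close>

definition fourier :: "('a::euclidean_space \<Rightarrow> complex) \<Rightarrow> 'a \<Rightarrow> complex" where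
  "fourier f \<xi> = (LINT x|lebesgue. f x * exp (- 2 * of_real pi * \<i> * of_real (x \<bullet> \<xi>)))"

definition fourier_dist ::
    "(('a::euclidean_space \<Rightarrow> complex) \<Rightarrow> complex) \<Rightarrow> ('a \<Rightarrow> complex) \<Rightarrow> complex" where
  "fourier_dist u = (\<lambda>g. u (fourier g))"

definition conv_dist ::
    "('a::euclidean_space \<Rightarrow> complex) \<Rightarrow> (('a \<Rightarrow> complex) \<Rightarrow> complex) \<Rightarrow> 'a \<Rightarrow> complex" where
  "conv_dist g u x = u (\<lambda>y. g (x - y))"

section \<open>Lebesgue norms\<close>

text \<open>Used for exponents \<open>r > 0\<close> only.\<close>

definition ennpowr :: "ennreal \<Rightarrow> real \<Rightarrow> ennreal" where
  "ennpowr t r = (if t = \<infinity> then \<infinity> else ennreal (enn2real t powr r))"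

definition Lp_norm :: "ennreal \<Rightarrow> ('a::euclidean_space \<Rightarrow> complex) \<Rightarrow> ennreal" where
  "Lp_norm a f =
     (if a = \<infinity> then esssup lebesgue (\<lambda>x. ennreal (cmod (f x)))
      else ennpowr (\<integral>\<^sup>+ x. ennreal (cmod (f x) powr enn2real a) \<partial>lebesgue) (1 / enn2real a))"

definition Lp_functions :: "ennreal \<Rightarrow> ('a::euclidean_space \<Rightarrow> complex) set" where
  "Lp_functions a = {f \<in> borel_measurable lebesgue. Lp_norm a f < \<infinity>}"

section \<open>Besov spaces\<close>

text \<open>The piece \<open>\<psi> k\<close> is the function \<open>\<phi>\<^sub>k\<close>; a Schwartz function is determined by its Fourier
  transform, so \<open>\<phi>\<close> determines the family \<open>\<psi>\<close>.\<close>

definition littlewood_paley ::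
    "('a::euclidean_space \<Rightarrow> complex) \<Rightarrow> (int \<Rightarrow> 'a \<Rightarrow> complex) \<Rightarrow> bool" where
  "littlewood_paley \<phi> \<psi> \<longleftrightarrow>
     schwartz \<phi> \<and>
     (\<exists>\<rho>::real \<Rightarrow> real. antimono_on {0..} \<rho> \<and> (\<forall>\<xi>. fourier \<phi> \<xi> = of_real (\<rho> (norm \<xi>)))) \<and>
     (\<forall>\<xi>. norm \<xi> \<le> 1 \<longrightarrow> fourier \<phi> \<xi> = 1) \<and>
     (\<forall>\<xi>. norm \<xi> \<ge> 2 \<longrightarrow> fourier \<phi> \<xi> = 0) \<and>
     (\<forall>k. schwartz (\<psi> k)) \<and>
     (\<forall>\<xi>. fourier (\<psi> 0) \<xi> = fourier \<phi> (\<xi> /\<^sub>R 2) - fourier \<phi> \<xi>) \<and>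
     (\<forall>k \<xi>. fourier (\<psi> k) \<xi> = fourier (\<psi> 0) ((2 powi (- k)) *\<^sub>R \<xi>))"

definition besov_norm ::
    "('a::euclidean_space \<Rightarrow> complex) \<Rightarrow> (int \<Rightarrow> 'a \<Rightarrow> complex) \<Rightarrow> ennreal \<Rightarrow> real \<Rightarrow> real \<Rightarrow>
     (('a \<Rightarrow> complex) \<Rightarrow> complex) \<Rightarrow> ennreal" where
  "besov_norm \<phi> \<psi> a b s u =
     ennpowr (ennpowr (Lp_norm a (conv_dist \<phi> u)) b +
              (\<Sum>\<^sub>\<infinity>k::nat. ennreal (2 powr (real k * s * b)) *
                         ennpowr (Lp_norm a (conv_dist (\<psi> (int k)) u)) b)) (1 / b)"

definition hom_besov_norm ::
    "(int \<Rightarrow> 'a::euclidean_space \<Rightarrow> complex) \<Rightarrow> ennreal \<Rightarrow> real \<Rightarrow> real \<Rightarrow>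
     (('a \<Rightarrow> complex) \<Rightarrow> complex) \<Rightarrow> ennreal" where
  "hom_besov_norm \<psi> a b s u =
     ennpowr (\<Sum>\<^sub>\<infinity>k::int. ennreal (2 powr (of_int k * s * b)) *
                        ennpowr (Lp_norm a (conv_dist (\<psi> k) u)) b) (1 / b)"

definition besov_space ::
    "('a::euclidean_space \<Rightarrow> complex) \<Rightarrow> (int \<Rightarrow> 'a \<Rightarrow> complex) \<Rightarrow> ennreal \<Rightarrow> real \<Rightarrow> real \<Rightarrow>
     (('a \<Rightarrow> complex) \<Rightarrow> complex) set" where
  "besov_space \<phi> \<psi> a b s = {u. tempered u \<and> besov_norm \<phi> \<psi> a b s u < \<infinity>}"

definition hom_besov_space ::
    "(int \<Rightarrow> 'a::euclidean_space \<Rightarrow> complex) \<Rightarrow> ennreal \<Rightarrow> real \<Rightarrow> real \<Rightarrow>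
     (('a \<Rightarrow> complex) \<Rightarrow> complex) set set" where
  "hom_besov_space \<psi> a b s = {poly_class u | u. tempered u \<and> hom_besov_norm \<psi> a b s u < \<infinity>}"

end

theory Submission
  imports Defs "HOL-Probability.Characteristic_Functions" "HOL-Probability.Sinc_Integral"
begin

text \<open>Since the multipliers are even, \<open>\<phi>\<^sub>k * \<F> f\<close> is the Fourier transform of \<open>f\<close> times the
  Fourier transform of \<open>\<phi>\<^sub>k\<close>, so the Hausdorff-Young inequality bounds the \<open>p\<close>-th power of its
  \<open>L\<close>-norm of exponent \<open>p'\<close> by the integral of \<open>\<bar>f\<bar>\<close> to the power \<open>p\<close> against a power of that
  multiplier. The multipliers take values in the unit interval and their sum telescopes to at most
  one, so summing over \<open>k\<close> gives the claim. As constants are irrelevant, Hausdorff-Young follows by real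
  interpolation from the trivial case \<open>p = 1\<close> and from Plancherel's inequality, which is obtained by
  inserting a Gaussian weight and letting its width tend to infinity.\<close>

text \<open>Hausdorff-Young is stated for integrable functions because \<open>fourier\<close> is a
  plain integral, whereas \<open>f\<close> itself is only in L^p. The Littlewood-Paley cut-offs
  close this gap: each multiplier has bounded support, so its product with \<open>f\<close> is
  integrable, and the constant does not depend on the size of that support. The p-th power of the
  norm is kept throughout because, once m^p \<le> m is used, the bound is additive in the multiplier
  m and all scales can be summed under one integral. The weight makes Plancherel accessible to
  Fubini: the squared transform is not known to be integrable in advance. A Gaussian is taken
  because its transform is explicit, nonnegative and of mass 1. Interpolation degenerates at p = 2,
  where its constant contains 1 / (q - 2), so there Plancherel is used directly. That the transform
  of \<open>f\<close> is tempered is a separate matter: it rests on a decay estimate for the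
  transforms of Schwartz functions in terms of a single seminorm.\<close>

section \<open>Product integrals, an integrable weight and the one-dimensional Gaussian\<close>

text \<open>\<open>lborel_eq\<close> presents Lebesgue measure as the image of a finite product of
  one-dimensional ones, where Fubini for products applies. The codomain is general because the real
  weights and the complex Gaussian integrands both use it.\<close>

lemma
  fixes f :: "'a::euclidean_space \<Rightarrow> real \<Rightarrow> 'b::{real_normed_field,banach,second_countable_topology}"
  assumes f: "\<And>b. b \<in> Basis \<Longrightarrow> integrable lborel (f b)"
  shows integrable_lborel_prod: "integrable lborel (\<lambda>x::'a. \<Prod>b\<in>Basis. f b (x \<bullet> b))"
    and integral_lborel_prod: "(LINT x|lborel. (\<Prod>b\<in>Basis. f b (x \<bullet> b))) = (\<Prod>b\<in>Basis. integral\<^sup>L lborel (f b))"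
proof -
  interpret product_sigma_finite "\<lambda>_::'a. lborel :: real measure"
    by standard
  have [measurable]: "f b \<in> borel_measurable borel" if "b \<in> Basis" for b
    using f[OF that] by auto
  have [measurable]: "(\<lambda>x::'a. \<Prod>b\<in>Basis. f b (x \<bullet> b)) \<in> borel_measurable borel"
    by measurable
  have coord: "(\<Prod>b\<in>Basis. f b ((\<Sum>b'\<in>Basis. x b' *\<^sub>R b') \<bullet> b)) = (\<Prod>b\<in>Basis. f b (x b))" for x
    by (intro prod.cong refl) simp
  show "integrable lborel (\<lambda>x::'a. \<Prod>b\<in>Basis. f b (x \<bullet> b))"
    using product_integrable_prod[of Basis f] f
    by (subst lborel_eq) (simp add: integrable_distr_eq coord)
  show "(LINT x|lborel. (\<Prod>b\<in>Basis. f b (x \<bullet> b))) = (\<Prod>b\<in>Basis. integral\<^sup>L lborel (f b))"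
    using product_integral_prod[of Basis f] f
    by (subst lborel_eq) (simp add: integral_distr coord)
qed

text \<open>The integral over the positive half-line is known; reflection gives the negative one,
  and together they miss only the null set {0}.\<close>

lemma integrable_one_div_one_plus_square: "integrable lborel (\<lambda>x::real. 1 / (1 + x\<^sup>2))"
proof -
  have pos: "set_integrable lborel {0<..} (\<lambda>x::real. 1 / (1 + x\<^sup>2))"
    using integrable_I0i_1_div_plus_square
    by (simp add: interval_lebesgue_integrable_def zero_ereal_def)
  \<comment> \<open>The reflection is written \<open>0 + (-1) * x\<close> to match the affine
    substitution rule.\<close>
  then have "integrable lborel (\<lambda>x::real. indicator {0<..} (0 + (-1) * x) *\<^sub>R (1 / (1 + (0 + (-1) * x)\<^sup>2)))"
    unfolding set_integrable_def by (subst lborel_integrable_real_affine_iff) auto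
  with pos have "integrable lborel (\<lambda>x::real. indicator {0<..} x *\<^sub>R (1 / (1 + x\<^sup>2)) + indicator {..<0} x *\<^sub>R (1 / (1 + x\<^sup>2)))"
    unfolding set_integrable_def
    by (intro Bochner_Integration.integrable_add) (auto simp: indicator_def)
  moreover have "AE x::real in lborel. indicator {0<..} x *\<^sub>R (1 / (1 + x\<^sup>2)) + indicator {..<0} x *\<^sub>R (1 / (1 + x\<^sup>2)) = 1 / (1 + x\<^sup>2)"
    using AE_lborel_singleton[of 0]
  proof eventually_elim
    case (elim x) then show ?case by (auto simp: indicator_def)
  qed
  ultimately show ?thesis
    by (subst (asm) integrable_cong_AE) auto
qed

text \<open>The exponent is twice the dimension so that the comparison works coordinate by
  coordinate: each factor 1 + (x \<bullet> b)^2 is at most (1 + norm x)^2. This weight dominates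
  every Schwartz function and its transform below.\<close>

lemma integrable_inverse_power_norm:
  "integrable lborel (\<lambda>x::'a::euclidean_space. inverse ((1 + norm x) ^ (2 * DIM('a))))"
proof (rule Bochner_Integration.integrable_bound)
  show "integrable lborel (\<lambda>x::'a. \<Prod>b\<in>Basis. 1 / (1 + (x \<bullet> b)\<^sup>2))"
    by (rule integrable_lborel_prod) (rule integrable_one_div_one_plus_square)
  show "AE x::'a in lborel. norm (inverse ((1 + norm x) ^ (2 * DIM('a)))) \<le> norm (\<Prod>b\<in>Basis. 1 / (1 + (x \<bullet> b)\<^sup>2))"
  proof (rule AE_I2)
    fix x :: 'a
    have "(\<Prod>b\<in>(Basis::'a set). (1 + (x \<bullet> b)\<^sup>2)) \<le> (\<Prod>b\<in>(Basis::'a set). (1 + norm x)\<^sup>2)"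
    proof (intro prod_mono conjI)
      fix b :: 'a assume b: "b \<in> Basis"
      have "(x \<bullet> b)\<^sup>2 \<le> (norm x)\<^sup>2"
        using Basis_le_norm[OF b, of x] by (metis abs_ge_zero power2_abs power_mono)
      then show "1 + (x \<bullet> b)\<^sup>2 \<le> (1 + norm x)\<^sup>2"
        by (simp add: power2_sum) (use norm_ge_zero[of x] in linarith)
    qed simp
    also have "\<dots> = (1 + norm x) ^ (2 * DIM('a))"
      by (simp add: power_mult)
    finally have le: "(\<Prod>b\<in>(Basis::'a set). (1 + (x \<bullet> b)\<^sup>2)) \<le> (1 + norm x) ^ (2 * DIM('a))" .
    have pos: "0 < (\<Prod>b\<in>(Basis::'a set). (1 + (x \<bullet> b)\<^sup>2))"
      by (intro prod_pos) (simp add: add_pos_nonneg)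
    have "(\<Prod>b\<in>(Basis::'a set). 1 / (1 + (x \<bullet> b)\<^sup>2)) = inverse (\<Prod>b\<in>(Basis::'a set). (1 + (x \<bullet> b)\<^sup>2))"
      by (simp add: prod_inversef[symmetric] divide_inverse comp_def)
    with le pos show "norm (inverse ((1 + norm x) ^ (2 * DIM('a)))) \<le> norm (\<Prod>b\<in>Basis. 1 / (1 + (x \<bullet> b)\<^sup>2))"
      by (simp add: le_imp_inverse_le)
  qed
qed measurable

text \<open>The characteristic function of the standard normal distribution, rescaled. The Gaussian
  is normalised so that its transform is exactly a probability density of standard deviation
  \<sigma>.\<close>

lemma normal_density_fourier:
  assumes "\<sigma> > 0"
  shows "has_bochner_integral lborel
    (\<lambda>x. of_real (exp (- (2 * pi * \<sigma> * x)\<^sup>2 / 2)) * exp (- 2 * of_real pi * \<i> * of_real (x * t)))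
    (complex_of_real (normal_density 0 \<sigma> t))"
proof -
  let ?c = "2 * pi * \<sigma>"
  let ?g = "\<lambda>y. of_real (exp (- y\<^sup>2 / 2)) * exp (\<i> * of_real (- t / \<sigma> * y)) :: complex"
  have std: "std_normal_density y *\<^sub>R exp (\<i> * of_real (- t / \<sigma> * y)) = (1 / sqrt (2 * pi)) *\<^sub>R ?g y" for y
    by (simp add: std_normal_density_def scaleR_conv_of_real)
  have int: "integrable lborel (\<lambda>y. std_normal_density y *\<^sub>R exp (\<i> * of_real (- t / \<sigma> * y)))"
    by (rule Bochner_Integration.integrable_bound[OF integrable_std_normal_moment[of 0]])
       (auto simp: normal_density_nonneg)
  have "(LINT y|lborel. std_normal_density y *\<^sub>R exp (\<i> * of_real (- t / \<sigma> * y))) = char std_normal_distribution (- t / \<sigma>)"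
    unfolding char_def by (subst integral_density) (auto simp: normal_density_nonneg mult_ac)
  also have "\<dots> = of_real (exp (- (t / \<sigma>)\<^sup>2 / 2))"
    by (simp add: char_std_normal_distribution)
  finally have "has_bochner_integral lborel (\<lambda>y. (1 / sqrt (2 * pi)) *\<^sub>R ?g y) (of_real (exp (- (t / \<sigma>)\<^sup>2 / 2)))"
    using int unfolding std by (simp add: has_bochner_integral_iff)
  then have "has_bochner_integral lborel (\<lambda>y. sqrt (2 * pi) *\<^sub>R (1 / sqrt (2 * pi)) *\<^sub>R ?g y)
      (sqrt (2 * pi) *\<^sub>R of_real (exp (- (t / \<sigma>)\<^sup>2 / 2)))"
    by (rule has_bochner_integral_scaleR_right)
  then have "has_bochner_integral lborel ?g (sqrt (2 * pi) *\<^sub>R of_real (exp (- (t / \<sigma>)\<^sup>2 / 2)))"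
    by (simp add: mult_ac)
  \<comment> \<open>Substituting y = \<open>?c * x\<close> turns the phase - t / \<sigma> * y into -
    2 * pi * x * t.\<close>
  then have "has_bochner_integral lborel (\<lambda>x. ?g (0 + ?c * x)) ((sqrt (2 * pi) *\<^sub>R of_real (exp (- (t / \<sigma>)\<^sup>2 / 2))) /\<^sub>R \<bar>?c\<bar>)"
    using assms by (subst (asm) lborel_has_bochner_integral_real_affine_iff[of ?c _ _ 0]) auto
  moreover have "?g (0 + ?c * x) = of_real (exp (- (?c * x)\<^sup>2 / 2)) * exp (- 2 * of_real pi * \<i> * of_real (x * t))" for x
    using assms by (simp add: field_simps)
  moreover have "(sqrt (2 * pi) *\<^sub>R of_real (exp (- (t / \<sigma>)\<^sup>2 / 2))) /\<^sub>R \<bar>?c\<bar> = complex_of_real (normal_density 0 \<sigma> t)"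
  proof -
    have "sqrt (2 * pi) / (2 * pi) = 1 / sqrt (2 * pi)"
      using real_div_sqrt[of "2 * pi"] by (simp add: field_simps)
    then have "sqrt (2 * pi) / \<bar>?c\<bar> = 1 / sqrt (2 * pi * \<sigma>\<^sup>2)"
      using assms by (simp add: real_sqrt_mult abs_mult field_simps)
    then show ?thesis
      using assms by (simp add: normal_density_def scaleR_conv_of_real power_divide field_simps flip: of_real_mult)
  qed
  ultimately show ?thesis by simp
qed

section \<open>Plancherel's inequality\<close>

definition character :: "'a::euclidean_space \<Rightarrow> 'a \<Rightarrow> complex" where
  "character x \<xi> = exp (- 2 * of_real pi * \<i> * of_real (x \<bullet> \<xi>))"

lemma norm_character [simp]: "cmod (character x \<xi>) = 1"
  by (simp add: character_def)

lemma character_commute: "character x \<xi> = character \<xi> x"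
  by (simp add: character_def inner_commute)

lemma character_add_left: "character (x + y) \<xi> = character x \<xi> * character y \<xi>"
  by (simp add: character_def inner_add_left algebra_simps flip: exp_add)

lemma character_add_right: "character x (\<xi> + \<eta>) = character x \<xi> * character x \<eta>"
  by (simp add: character_def inner_add_right algebra_simps flip: exp_add)

lemma cnj_character: "cnj (character x \<xi>) = character x (- \<xi>)"
  by (simp add: character_def exp_cnj)

lemma measurable_character [measurable (raw)]:
  assumes [measurable]: "f \<in> borel_measurable M" "g \<in> borel_measurable M"
  shows "(\<lambda>x. character (f x) (g x)) \<in> borel_measurable M"
  unfolding character_def by measurable

text \<open>\<open>fourier\<close> integrates over the completed measure; Fubini is applied on
  \<open>lborel\<close>, to which Borel functions may be transferred.\<close>

lemma fourier_lborel:
  assumes [measurable]: "g \<in> borel_measurable borel"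
  shows "fourier g \<xi> = (LINT x|lborel. g x * character x \<xi>)"
  unfolding fourier_def character_def by (rule integral_completion) measurable

lemma measurable_fourier [measurable]:
  assumes [measurable]: "g \<in> borel_measurable borel"
  shows "fourier g \<in> borel_measurable borel"
proof -
  have "fourier g = (\<lambda>\<xi>. LINT x|lborel. g x * character x \<xi>)"
    using fourier_lborel[OF assms] by blast
  also have "\<dots> \<in> borel_measurable borel"
    by measurable
  finally show ?thesis .
qed

lemma integrable_mult_character:
  assumes "integrable lborel g"
  shows "integrable lborel (\<lambda>x. g x * character x \<xi>)"
  by (rule Bochner_Integration.integrable_bound[OF assms])
     (use assms[THEN borel_measurable_integrable] in \<open>auto simp: norm_mult\<close>)

text \<open>A non-integrable function has Bochner integral 0 by convention, so the bound persists
  there. This keeps integrability conditions out of the estimates below.\<close>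

lemma ennreal_norm_integral_le:
  fixes f :: "_ \<Rightarrow> _ :: {banach, second_countable_topology}"
  shows "ennreal (norm (integral\<^sup>L M f)) \<le> (\<integral>\<^sup>+x. ennreal (norm (f x)) \<partial>M)"
  by (cases "integrable M f") (auto simp: integral_norm_bound_ennreal not_integrable_integral_eq)

lemma norm_fourier_le:
  assumes [measurable]: "g \<in> borel_measurable borel"
  shows "ennreal (cmod (fourier g \<xi>)) \<le> (\<integral>\<^sup>+x. ennreal (cmod (g x)) \<partial>lborel)"
  using ennreal_norm_integral_le[of lborel "\<lambda>x. g x * character x \<xi>"]
  by (simp add: fourier_lborel norm_mult)

text \<open>The double integrand is dominated by |u x| * |v y|, which is integrable on the product,
  so Fubini applies. The kernels in view are characters and products of characters.\<close>

lemma integral_swap_bounded_kernel: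
  fixes u v :: "'a::euclidean_space \<Rightarrow> complex"
  assumes u: "integrable lborel u" and v: "integrable lborel v"
    and e[measurable]: "(\<lambda>z. e (fst z) (snd z)) \<in> borel_measurable (borel \<Otimes>\<^sub>M borel)"
    and le: "\<And>x y. cmod (e x y) \<le> 1"
  shows "(LINT x|lborel. u x * (LINT y|lborel. v y * e x y)) =
         (LINT y|lborel. v y * (LINT x|lborel. u x * e x y))"
proof -
  have [measurable]: "u \<in> borel_measurable borel" "v \<in> borel_measurable borel"
    using u v by auto
  have e1[measurable]: "(\<lambda>y. e x y) \<in> borel_measurable borel" for x
    using measurable_compose[OF _ e, of "\<lambda>y. (x, y)" borel] by simp
  have ve: "integrable lborel (\<lambda>y. v y * e x y)" for x
    by (rule Bochner_Integration.integrable_bound[OF v]) (auto simp: norm_mult intro!: mult_left_le le)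
  have "integrable (lborel \<Otimes>\<^sub>M lborel) (\<lambda>(x, y). u x * (v y * e x y))"
  proof (rule lborel_pair.Fubini_integrable)
    show "integrable lborel (\<lambda>x. LINT y|lborel. norm ((\<lambda>(x, y). u x * (v y * e x y)) (x, y)))"
    proof (rule Bochner_Integration.integrable_bound)
      show "integrable lborel (\<lambda>x. u x * of_real (LINT y|lborel. cmod (v y)))"
        using u by simp
      show "AE x in lborel. norm (LINT y|lborel. norm ((\<lambda>(x, y). u x * (v y * e x y)) (x, y)))
          \<le> norm (u x * of_real (LINT y|lborel. cmod (v y)))"
      proof (rule AE_I2)
        fix x
        have "(LINT y|lborel. cmod (v y * e x y)) \<le> (LINT y|lborel. cmod (v y))"
          by (intro integral_mono integrable_norm ve v) (auto simp: norm_mult intro!: mult_left_le le)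
        then show "norm (LINT y|lborel. norm ((\<lambda>(x, y). u x * (v y * e x y)) (x, y)))
            \<le> norm (u x * of_real (LINT y|lborel. cmod (v y)))"
          by (simp add: norm_mult[of "u x"] abs_mult mult_left_mono)
      qed
    qed measurable
    show "AE x in lborel. integrable lborel (\<lambda>y. (\<lambda>(x, y). u x * (v y * e x y)) (x, y))"
      using ve by simp
  qed measurable
  from lborel_pair.Fubini_integral[OF this]
  have "(LINT y|lborel. LINT x|lborel. u x * (v y * e x y)) = (LINT x|lborel. LINT y|lborel. u x * (v y * e x y))" .
  moreover have "(LINT x|lborel. u x * (v y * e x y)) = v y * (LINT x|lborel. u x * e x y)" for y
    by (simp add: mult.left_commute flip: integral_mult_right_zero)
  ultimately show ?thesis by simp
qed

lemma nn_integral_lborel_translate: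
  fixes f :: "'a::euclidean_space \<Rightarrow> ennreal"
  assumes [measurable]: "f \<in> borel_measurable borel"
  shows "(\<integral>\<^sup>+x. f (x + c) \<partial>lborel) = (\<integral>\<^sup>+x. f x \<partial>lborel)"
  by (subst (2) lborel_distr_plus[of c, symmetric]) (simp add: nn_integral_distr add.commute)

section \<open>Gaussian-weighted Plancherel inequality\<close>

context
  fixes \<sigma> :: real
  assumes \<sigma>: "\<sigma> > 0"
begin

lemma gaussian_prod:
  "exp (- (2 * pi * \<sigma> * norm x)\<^sup>2 / 2) = (\<Prod>b\<in>Basis. exp (- (2 * pi * \<sigma> * (x \<bullet> b))\<^sup>2 / 2))"
  for x :: "'a::euclidean_space"
  by (simp add: euclidean_inner[of x x] power2_norm_eq_inner power_mult_distrib sum_distrib_left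
      sum_divide_distrib flip: exp_sum sum_negf power2_eq_square)

lemma integrable_gaussian: "integrable lborel (\<lambda>x::'a::euclidean_space. exp (- (2 * pi * \<sigma> * norm x)\<^sup>2 / 2))"
proof -
  have "integrable lborel (\<lambda>x. cmod (of_real (exp (- (2 * pi * \<sigma> * x)\<^sup>2 / 2)) * exp (- 2 * of_real pi * \<i> * of_real (x * 0))))"
    using normal_density_fourier[OF \<sigma>, of 0] by (intro integrable_norm) (simp add: has_bochner_integral_iff)
  then have "integrable lborel (\<lambda>x::real. exp (- (2 * pi * \<sigma> * x)\<^sup>2 / 2))"
    by simp
  then show ?thesis
    unfolding gaussian_prod by (rule integrable_lborel_prod)
qed

lemma fourier_gaussian:
  "(LINT x|lborel. of_real (exp (- (2 * pi * \<sigma> * norm x)\<^sup>2 / 2)) * character x t) =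
   of_real (\<Prod>b\<in>Basis. normal_density 0 \<sigma> (t \<bullet> b))"
proof -
  have ch: "character x t = (\<Prod>b\<in>Basis. exp (- 2 * of_real pi * \<i> * of_real ((x \<bullet> b) * (t \<bullet> b))))" for x
    by (simp add: character_def euclidean_inner[of x t] sum_distrib_left flip: exp_sum sum_negf)
  have "(LINT x|lborel. of_real (exp (- (2 * pi * \<sigma> * norm x)\<^sup>2 / 2)) * character x t) =
    (LINT x|lborel. (\<Prod>b\<in>Basis. of_real (exp (- (2 * pi * \<sigma> * (x \<bullet> b))\<^sup>2 / 2)) * exp (- 2 * of_real pi * \<i> * of_real ((x \<bullet> b) * (t \<bullet> b)))))"
    unfolding gaussian_prod ch of_real_prod prod.distrib ..
  also have "\<dots> = (\<Prod>b\<in>Basis. LINT x|lborel. of_real (exp (- (2 * pi * \<sigma> * x)\<^sup>2 / 2)) * exp (- 2 * of_real pi * \<i> * of_real (x * (t \<bullet> b))))"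
    using normal_density_fourier[OF \<sigma>]
    by (intro integral_lborel_prod) (auto simp: has_bochner_integral_iff)
  also have "\<dots> = (\<Prod>b\<in>Basis. of_real (normal_density 0 \<sigma> (t \<bullet> b)))"
    using normal_density_fourier[OF \<sigma>]
    by (intro prod.cong refl) (simp add: has_bochner_integral_iff)
  finally show ?thesis by simp
qed

lemma nn_integral_normal_density_prod:
  "(\<integral>\<^sup>+t. ennreal (\<Prod>b\<in>Basis. normal_density 0 \<sigma> ((t::'a::euclidean_space) \<bullet> b)) \<partial>lborel) = 1"
proof -
  have "(\<integral>\<^sup>+t. ennreal (normal_density 0 \<sigma> t) \<partial>lborel) = 1"
    using \<sigma> by (subst nn_integral_eq_integral) auto
  moreover have "(\<integral>\<^sup>+t. ennreal (\<Prod>b\<in>Basis. normal_density 0 \<sigma> ((t::'a) \<bullet> b)) \<partial>lborel) =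
      (\<integral>\<^sup>+t. (\<Prod>b\<in>Basis. ennreal (normal_density 0 \<sigma> ((t::'a) \<bullet> b))) \<partial>lborel)"
    by (simp add: prod_ennreal normal_density_nonneg)
  ultimately show ?thesis
    by (subst (asm) nn_integral_lborel_prod) auto
qed

text \<open>Writing the square as the transform times its conjugate and applying Fubini twice gives
  the double integral of cnj (g \<eta>) * g \<xi> * N (\<xi> - \<eta>), where \<open>N\<close> is
  the transform of the weight \<open>K\<close>. Since \<open>N\<close> is nonnegative with mass 1 in
  each variable, Schur's test bounds this by the integral of the square of |g|, which may be
  infinite.\<close>

lemma gaussian_fourier_square_le:
  assumes g: "integrable lborel g"
  shows "(\<integral>\<^sup>+x. ennreal (exp (- (2 * pi * \<sigma> * norm x)\<^sup>2 / 2) * (cmod (fourier g x))\<^sup>2) \<partial>lborel)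
    \<le> (\<integral>\<^sup>+x. ennreal ((cmod (g x))\<^sup>2) \<partial>lborel)"
proof -
  define K where "K = (\<lambda>x::'a. exp (- (2 * pi * \<sigma> * norm x)\<^sup>2 / 2))"
  define N where "N = (\<lambda>t::'a. \<Prod>b\<in>Basis. normal_density 0 \<sigma> (t \<bullet> b))"
  have g_m[measurable]: "g \<in> borel_measurable borel" using g by auto
  have K_int: "integrable lborel K" using integrable_gaussian by (simp add: K_def)
  have K_nonneg: "K x \<ge> 0" for x by (simp add: K_def)
  have N_nonneg: "N x \<ge> 0" for x by (simp add: N_def prod_nonneg normal_density_nonneg)
  have K_m[measurable]: "K \<in> borel_measurable borel" unfolding K_def by measurable
  have N_m[measurable]: "N \<in> borel_measurable borel" unfolding N_def by measurable
  have bound: "cmod (fourier g x) \<le> (LINT x|lborel. cmod (g x))" for x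
    using g integral_norm_bound[of lborel "\<lambda>y. g y * character y x"] by (simp add: fourier_lborel norm_mult)
  have Kg_int: "integrable lborel (\<lambda>x. of_real (K x) * fourier g x)"
  proof (rule Bochner_Integration.integrable_bound)
    show "integrable lborel (\<lambda>x. K x * (LINT x|lborel. cmod (g x)))"
      using K_int by simp
  qed (auto simp: norm_mult abs_mult K_nonneg intro!: mult_left_mono bound)
  have cnj_g: "integrable lborel (\<lambda>x. cnj (g x))" using g by simp
  \<comment> \<open>Transforming the weighted transform back yields \<open>g\<close> smoothed by
    \<open>N\<close>: the two characters combine to the frequency \<xi> - \<eta>, at which the
    transform of \<open>K\<close> is evaluated.\<close>
  have inner: "(LINT x|lborel. of_real (K x) * fourier g x * character x (- \<eta>)) =
      (LINT \<xi>|lborel. g \<xi> * of_real (N (\<xi> - \<eta>)))" for \<eta>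
  proof -
    have kernel: "(LINT x|lborel. of_real (K x) * (character \<xi> x * character x (- \<eta>))) = of_real (N (\<xi> - \<eta>))" for \<xi>
      using fourier_gaussian[of "\<xi> - \<eta>"]
      by (simp add: K_def N_def character_commute[of \<xi>] flip: character_add_right)
    have "(LINT x|lborel. of_real (K x) * fourier g x * character x (- \<eta>)) =
        (LINT x|lborel. of_real (K x) * (LINT \<xi>|lborel. g \<xi> * (character \<xi> x * character x (- \<eta>))))"
      by (simp add: fourier_lborel mult.assoc flip: integral_mult_left_zero)
    also have "\<dots> = (LINT \<xi>|lborel. g \<xi> * (LINT x|lborel. of_real (K x) * (character \<xi> x * character x (- \<eta>))))"
      using g K_int by (intro integral_swap_bounded_kernel) (auto simp: norm_mult)
    also have "\<dots> = (LINT \<xi>|lborel. g \<xi> * of_real (N (\<xi> - \<eta>)))"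
      unfolding kernel ..
    finally show ?thesis .
  qed
  have "complex_of_real (LINT x|lborel. K x * (cmod (fourier g x))\<^sup>2) =
      (LINT x|lborel. of_real (K x * (cmod (fourier g x))\<^sup>2))"
    by (rule integral_complex_of_real[symmetric])
  also have "\<dots> = (LINT x|lborel. of_real (K x) * fourier g x * cnj (fourier g x))"
    by (simp add: mult.assoc complex_norm_square del: of_real_power)
  also have "\<dots> = (LINT x|lborel. of_real (K x) * fourier g x * (LINT \<eta>|lborel. cnj (g \<eta>) * character x (- \<eta>)))"
  proof -
    have "cnj (fourier g x) = (LINT \<eta>|lborel. cnj (g \<eta>) * character x (- \<eta>))" for x
      by (simp add: fourier_lborel cnj_character character_commute[of _ x] flip: Bochner_Integration.integral_cnj)
    then show ?thesis by simp
  qed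
  also have "\<dots> = (LINT \<eta>|lborel. cnj (g \<eta>) * (LINT x|lborel. of_real (K x) * fourier g x * character x (- \<eta>)))"
    using Kg_int cnj_g by (intro integral_swap_bounded_kernel) auto
  also have "\<dots> = (LINT \<eta>|lborel. cnj (g \<eta>) * (LINT \<xi>|lborel. g \<xi> * of_real (N (\<xi> - \<eta>))))"
    unfolding inner ..
  finally have eq: "complex_of_real (LINT x|lborel. K x * (cmod (fourier g x))\<^sup>2) = \<dots>" .
  have K2_int: "integrable lborel (\<lambda>x. K x * (cmod (fourier g x))\<^sup>2)"
  proof (rule Bochner_Integration.integrable_bound)
    show "integrable lborel (\<lambda>x. K x * (LINT x|lborel. cmod (g x))\<^sup>2)"
      using K_int by simp
  qed (auto simp: norm_mult abs_mult K_nonneg intro!: mult_left_mono power_mono bound)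
  \<comment> \<open>Half of the target: the inequality 2ab \<le> a^2 + b^2 will produce two such
    terms.\<close>
  let ?J = "\<integral>\<^sup>+x. ennreal ((cmod (g x))\<^sup>2 / 2) \<partial>lborel"
  have N1: "(\<integral>\<^sup>+\<xi>. ennreal (N (\<xi> - \<eta>)) \<partial>lborel) = 1" for \<eta>
    using nn_integral_lborel_translate[of "\<lambda>x. ennreal (N x)" "- \<eta>"] nn_integral_normal_density_prod
    by (simp add: N_def)
  have N2: "(\<integral>\<^sup>+\<eta>. ennreal (N (\<xi> - \<eta>)) \<partial>lborel) = 1" for \<xi>
  proof -
    have "N (\<xi> - \<eta>) = N (\<eta> - \<xi>)" for \<eta>
      unfolding N_def normal_density_def
      by (intro prod.cong refl) (simp add: inner_diff_left power2_commute)
    then show ?thesis using N1 by simp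
  qed
  have "(\<integral>\<^sup>+x. ennreal (K x * (cmod (fourier g x))\<^sup>2) \<partial>lborel) = ennreal (LINT x|lborel. K x * (cmod (fourier g x))\<^sup>2)"
    using K2_int by (intro nn_integral_eq_integral) (auto simp: K_nonneg)
  \<comment> \<open>The integral is nonnegative, so taking the modulus loses nothing. Afterwards
    everything is an extended nonnegative integral and no square integrability of \<open>g\<close>
    has to be known.\<close>
  also have "\<dots> = ennreal (cmod (complex_of_real (LINT x|lborel. K x * (cmod (fourier g x))\<^sup>2)))"
    by (simp add: K_nonneg integral_nonneg)
  also have "\<dots> \<le> (\<integral>\<^sup>+\<eta>. ennreal (cmod (g \<eta>)) * ennreal (cmod (LINT \<xi>|lborel. g \<xi> * of_real (N (\<xi> - \<eta>)))) \<partial>lborel)"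
    unfolding eq by (rule order_trans[OF ennreal_norm_integral_le]) (simp add: norm_mult ennreal_mult)
  also have "\<dots> \<le> (\<integral>\<^sup>+\<eta>. ennreal (cmod (g \<eta>)) * (\<integral>\<^sup>+\<xi>. ennreal (cmod (g \<xi>) * N (\<xi> - \<eta>)) \<partial>lborel) \<partial>lborel)"
  proof (intro nn_integral_mono mult_left_mono)
    fix \<eta>
    show "ennreal (cmod (LINT \<xi>|lborel. g \<xi> * of_real (N (\<xi> - \<eta>)))) \<le> (\<integral>\<^sup>+\<xi>. ennreal (cmod (g \<xi>) * N (\<xi> - \<eta>)) \<partial>lborel)"
      by (rule order_trans[OF ennreal_norm_integral_le]) (simp add: norm_mult N_nonneg)
  qed auto
  also have "\<dots> = (\<integral>\<^sup>+\<eta>. (\<integral>\<^sup>+\<xi>. ennreal (cmod (g \<eta>) * (cmod (g \<xi>) * N (\<xi> - \<eta>))) \<partial>lborel) \<partial>lborel)"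
    by (simp add: N_nonneg ennreal_mult flip: nn_integral_cmult)
  also have "\<dots> \<le> (\<integral>\<^sup>+\<eta>. (\<integral>\<^sup>+\<xi>. ennreal ((cmod (g \<eta>))\<^sup>2 / 2) * ennreal (N (\<xi> - \<eta>)) +
      ennreal ((cmod (g \<xi>))\<^sup>2 / 2) * ennreal (N (\<xi> - \<eta>)) \<partial>lborel) \<partial>lborel)"
  proof (intro nn_integral_mono)
    fix \<eta> \<xi>
    have "cmod (g \<eta>) * cmod (g \<xi>) \<le> (cmod (g \<eta>))\<^sup>2 / 2 + (cmod (g \<xi>))\<^sup>2 / 2"
      using sum_squares_bound[of "cmod (g \<eta>)" "cmod (g \<xi>)"] by simp
    from mult_right_mono[OF this N_nonneg[of "\<xi> - \<eta>"]]
    show "ennreal (cmod (g \<eta>) * (cmod (g \<xi>) * N (\<xi> - \<eta>))) \<le> ennreal ((cmod (g \<eta>))\<^sup>2 / 2) * ennreal (N (\<xi> - \<eta>)) +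
      ennreal ((cmod (g \<xi>))\<^sup>2 / 2) * ennreal (N (\<xi> - \<eta>))"
      by (simp add: N_nonneg mult.assoc distrib_right flip: ennreal_mult ennreal_plus)
  qed
  also have "\<dots> = (\<integral>\<^sup>+\<eta>. (\<integral>\<^sup>+\<xi>. ennreal ((cmod (g \<eta>))\<^sup>2 / 2) * ennreal (N (\<xi> - \<eta>)) \<partial>lborel) \<partial>lborel) +
      (\<integral>\<^sup>+\<eta>. (\<integral>\<^sup>+\<xi>. ennreal ((cmod (g \<xi>))\<^sup>2 / 2) * ennreal (N (\<xi> - \<eta>)) \<partial>lborel) \<partial>lborel)"
    by (subst nn_integral_add[symmetric]) (auto simp: nn_integral_add)
  \<comment> \<open>In this term the order is exchanged so that the inner integral of
    \<open>N\<close> runs over the variable on which |g| does not depend; in the other term it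
    already does.\<close>
  also have "(\<integral>\<^sup>+\<eta>. (\<integral>\<^sup>+\<xi>. ennreal ((cmod (g \<xi>))\<^sup>2 / 2) * ennreal (N (\<xi> - \<eta>)) \<partial>lborel) \<partial>lborel) =
      (\<integral>\<^sup>+\<xi>. (\<integral>\<^sup>+\<eta>. ennreal ((cmod (g \<xi>))\<^sup>2 / 2) * ennreal (N (\<xi> - \<eta>)) \<partial>lborel) \<partial>lborel)"
    by (rule lborel_pair.Fubini') measurable
  also have "\<dots> = ?J"
    by (simp add: nn_integral_cmult N2)
  also have "(\<integral>\<^sup>+\<eta>. (\<integral>\<^sup>+\<xi>. ennreal ((cmod (g \<eta>))\<^sup>2 / 2) * ennreal (N (\<xi> - \<eta>)) \<partial>lborel) \<partial>lborel) = ?J"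
    by (simp add: nn_integral_cmult N1)
  also have "?J + ?J = (\<integral>\<^sup>+x. ennreal ((cmod (g x))\<^sup>2) \<partial>lborel)"
    by (subst nn_integral_add[symmetric]) (auto simp flip: ennreal_plus)
  finally show ?thesis by (simp add: K_def)
qed

end

text \<open>As \<open>s n\<close> tends to 0 the weight tends to 1 pointwise. The weighted bound is
  uniform in \<open>n\<close>, so Fatou's lemma removes the weight.\<close>

lemma nn_integral_fourier_square_le:
  assumes g: "integrable lborel g"
  shows "(\<integral>\<^sup>+x. ennreal ((cmod (fourier g x))\<^sup>2) \<partial>lborel) \<le> (\<integral>\<^sup>+x. ennreal ((cmod (g x))\<^sup>2) \<partial>lborel)"
proof -
  have [measurable]: "g \<in> borel_measurable borel" using g by auto
  define s :: "nat \<Rightarrow> real" where "s n = inverse (real (Suc n))" for n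
  let ?F = "\<lambda>n x. ennreal (exp (- (2 * pi * s n * norm x)\<^sup>2 / 2) * (cmod (fourier g x))\<^sup>2)"
  have lim: "(\<lambda>n. ?F n x) \<longlonglongrightarrow> ennreal ((cmod (fourier g x))\<^sup>2)" for x
  proof -
    have "s \<longlonglongrightarrow> 0" unfolding s_def[abs_def] by (rule LIMSEQ_inverse_real_of_nat)
    then have "(\<lambda>n. exp (- (2 * pi * s n * norm x)\<^sup>2 / 2) * (cmod (fourier g x))\<^sup>2) \<longlonglongrightarrow>
        exp (- (2 * pi * 0 * norm x)\<^sup>2 / 2) * (cmod (fourier g x))\<^sup>2"
      by (intro tendsto_intros) auto
    then show ?thesis by (intro tendsto_ennrealI) simp
  qed
  have "(\<integral>\<^sup>+x. ennreal ((cmod (fourier g x))\<^sup>2) \<partial>lborel) = (\<integral>\<^sup>+x. liminf (\<lambda>n. ?F n x) \<partial>lborel)"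
    using lim_imp_Liminf[OF sequentially_bot lim] by simp
  also have "\<dots> \<le> liminf (\<lambda>n. \<integral>\<^sup>+x. ?F n x \<partial>lborel)"
    by (rule nn_integral_liminf) measurable
  also have "\<dots> \<le> (\<integral>\<^sup>+x. ennreal ((cmod (g x))\<^sup>2) \<partial>lborel)"
    by (intro Liminf_le always_eventually allI gaussian_fourier_square_le g) (auto simp: s_def)
  finally show ?thesis .
qed

section \<open>The Hausdorff-Young inequality\<close>

lemma nn_integral_powr_from_0:
  fixes a c :: real
  assumes "a > -1" "c \<ge> 0"
  shows "(\<integral>\<^sup>+x. ennreal (x powr a) * indicator {0<..c} x \<partial>lborel) = ennreal (c powr (a + 1) / (a + 1))"
proof -
  \<comment> \<open>The endpoint 0 may be added because \<open>0 powr a\<close> is 0 even for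
    negative exponents.\<close>
  have "(\<integral>\<^sup>+x. ennreal (x powr a) * indicator {0<..c} x \<partial>lborel) =
      (\<integral>\<^sup>+x. ennreal (x powr a) * indicator {0..c} x \<partial>lborel)"
    by (intro nn_integral_cong) (auto simp: indicator_def)
  also have "\<dots> = ennreal (c powr (a + 1) / (a + 1))"
    by (rule nn_integral_has_integral_lebesgue'[OF _ has_integral_powr_from_0]) (use assms in auto)
  finally show ?thesis .
qed

text \<open>The height at which \<open>g\<close> is cut depends on \<open>s\<close> in such a way that the integrable part contributes
  at most \<open>s / 2\<close> to the Fourier transform.\<close>

lemma fourier_level_set_le:
  fixes g :: "'a::euclidean_space \<Rightarrow> complex"
  assumes g: "integrable lborel g" and gp: "integrable lborel (\<lambda>x. cmod (g x) powr p)"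
    and A: "A = (LINT x|lborel. cmod (g x) powr p)" "A > 0" and s: "s > 0"
  shows "(\<integral>\<^sup>+x. indicator {s..} (cmod (fourier g x)) \<partial>lborel) \<le>
    (\<integral>\<^sup>+x. ennreal (4 / s\<^sup>2) * (ennreal ((cmod (g x))\<^sup>2) * indicator {..2 * A} (s * cmod (g x) powr (p - 1))) \<partial>lborel)"
proof -
  have g_m[measurable]: "g \<in> borel_measurable borel" using g by auto
  define g2 where "g2 x = (if s * cmod (g x) powr (p - 1) \<le> 2 * A then g x else 0)" for x
  define g1 where "g1 x = (if s * cmod (g x) powr (p - 1) \<le> 2 * A then 0 else g x)" for x
  have g2_m[measurable]: "g2 \<in> borel_measurable borel" unfolding g2_def[abs_def] by measurable
  have g1_m[measurable]: "g1 \<in> borel_measurable borel" unfolding g1_def[abs_def] by measurable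
  have g1_int: "integrable lborel g1"
    by (rule Bochner_Integration.integrable_bound[OF g]) (auto simp: g1_def)
  have g2_int: "integrable lborel g2"
    by (rule Bochner_Integration.integrable_bound[OF g]) (auto simp: g2_def)
  have split: "fourier g x = fourier g1 x + fourier g2 x" for x
  proof -
    have "fourier g x = (LINT y|lborel. g1 y * character y x + g2 y * character y x)"
      unfolding fourier_lborel[OF g_m] by (intro Bochner_Integration.integral_cong) (auto simp: g1_def g2_def)
    then show ?thesis
      using integrable_mult_character[OF g1_int] integrable_mult_character[OF g2_int]
      by (simp add: fourier_lborel)
  qed
  \<comment> \<open>Where \<open>g1\<close> is nonzero, s * |g|^(p - 1) exceeds 2 * A, so |g| is at
    most s / (2 * A) times |g|^p. Integrating gives s / (2 * A) * A = s / 2.\<close>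
  have "(\<integral>\<^sup>+x. ennreal (cmod (g1 x)) \<partial>lborel) \<le> (\<integral>\<^sup>+x. ennreal (s / (2 * A) * cmod (g x) powr p) \<partial>lborel)"
  proof (intro nn_integral_mono ennreal_leI)
    fix x
    show "cmod (g1 x) \<le> s / (2 * A) * cmod (g x) powr p"
    proof (cases "s * cmod (g x) powr (p - 1) \<le> 2 * A")
      case False
      then have "1 * cmod (g x) \<le> s / (2 * A) * cmod (g x) powr (p - 1) * cmod (g x)"
        using A s by (intro mult_right_mono) (auto simp: field_simps)
      also have "\<dots> = s / (2 * A) * cmod (g x) powr p"
        using powr_mult_base[of "cmod (g x)" "p - 1"] by (simp add: mult_ac)
      finally show ?thesis using False by (simp add: g1_def)
    qed (use A s in \<open>auto simp: g1_def\<close>)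
  qed
  also have "\<dots> = ennreal (s / (2 * A) * A)"
    using gp A s by (subst nn_integral_eq_integral) auto
  also have "\<dots> = ennreal (s / 2)" using A by simp
  finally have g1_le: "cmod (fourier g1 x) \<le> s / 2" for x
    using norm_fourier_le[OF g1_m, of x] s by (meson ennreal_le_iff half_gt_zero less_imp_le order_trans)
  have "(\<integral>\<^sup>+x. indicator {s..} (cmod (fourier g x)) \<partial>lborel) \<le>
      (\<integral>\<^sup>+x. ennreal (4 / s\<^sup>2) * ennreal ((cmod (fourier g2 x))\<^sup>2) \<partial>lborel)"
  proof (intro nn_integral_mono)
    fix x
    show "indicator {s..} (cmod (fourier g x)) \<le> ennreal (4 / s\<^sup>2) * ennreal ((cmod (fourier g2 x))\<^sup>2)"
    proof (cases "s \<le> cmod (fourier g x)")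
      case True
      \<comment> \<open>On the level set the remaining s / 2 must come from \<open>g2\<close>;
        Chebyshev's inequality with the square then gives the factor 4 / s^2.\<close>
      then have "s / 2 \<le> cmod (fourier g2 x)"
        using g1_le[of x] norm_triangle_ineq[of "fourier g1 x" "fourier g2 x"] by (simp add: split)
      then have "(s / 2)\<^sup>2 \<le> (cmod (fourier g2 x))\<^sup>2"
        using s by (intro power_mono) auto
      then have "1 \<le> 4 / s\<^sup>2 * (cmod (fourier g2 x))\<^sup>2"
        using s by (simp add: field_simps)
      then show ?thesis
        using True by (simp flip: ennreal_mult)
    qed auto
  qed
  also have "\<dots> = ennreal (4 / s\<^sup>2) * (\<integral>\<^sup>+x. ennreal ((cmod (fourier g2 x))\<^sup>2) \<partial>lborel)"
    by (intro nn_integral_cmult) measurable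
  also have "\<dots> \<le> ennreal (4 / s\<^sup>2) * (\<integral>\<^sup>+x. ennreal ((cmod (g2 x))\<^sup>2) \<partial>lborel)"
    by (intro mult_left_mono nn_integral_fourier_square_le g2_int) auto
  also have "\<dots> = (\<integral>\<^sup>+x. ennreal (4 / s\<^sup>2) * ennreal ((cmod (g2 x))\<^sup>2) \<partial>lborel)"
    by (intro nn_integral_cmult[symmetric]) measurable
  also have "\<dots> = (\<integral>\<^sup>+x. ennreal (4 / s\<^sup>2) * (ennreal ((cmod (g x))\<^sup>2) * indicator {..2 * A} (s * cmod (g x) powr (p - 1))) \<partial>lborel)"
    by (intro nn_integral_cong) (auto simp: g2_def)
  finally show ?thesis .
qed

text \<open>The level set bound is inserted into the layer-cake formula and the integrals are
  exchanged. For fixed x the truncation confines s to an interval (0, \<Lambda>], on which s^(q - 3)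
  is integrable precisely because q > 2. Making the cut depend on \<open>A\<close> as well as on s
  yields the homogeneous power A^(q - 1).\<close>

lemma nn_integral_fourier_powr_le:
  fixes g :: "'a::euclidean_space \<Rightarrow> complex"
  assumes g: "integrable lborel g" and gp: "integrable lborel (\<lambda>x. cmod (g x) powr p)"
    and p: "1 < p" "p < 2" and q: "1 / p + 1 / q = 1"
    and A: "A = (LINT x|lborel. cmod (g x) powr p)"
  shows "(\<integral>\<^sup>+x. ennreal (cmod (fourier g x) powr q) \<partial>lborel) \<le> ennreal (4 * q * 2 powr (q - 2) / (q - 2) * A powr (q - 1))"
proof (cases "A = 0")
  case True
  have [measurable]: "g \<in> borel_measurable borel" using g by auto
  \<comment> \<open>The cut divides by \<open>A\<close>, so A = 0 is separate: then \<open>g\<close>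
    vanishes almost everywhere and its transform is identically 0.\<close>
  have "AE x in lborel. cmod (g x) powr p = 0"
    using integral_nonneg_eq_0_iff_AE[OF gp] A True by simp
  then have "(\<integral>\<^sup>+x. ennreal (cmod (g x)) \<partial>lborel) = (\<integral>\<^sup>+x. 0 \<partial>(lborel :: 'a measure))"
    by (intro nn_integral_cong_AE) auto
  then have "cmod (fourier g x) = 0" for x
    using norm_fourier_le[of g x] by simp
  then show ?thesis by simp
next
  case False
  have [measurable]: "g \<in> borel_measurable borel" using g by auto
  have A_pos: "A > 0"
  proof -
    have "A \<ge> 0" unfolding A by (rule Bochner_Integration.integral_nonneg) simp
    with False show ?thesis by simp
  qed
  have q_eq: "q = p / (p - 1)"
    using q p by (cases "q = 0") (auto simp: field_simps)
  have q2: "q > 2" using p by (simp add: q_eq field_simps)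
  have pq: "(p - 1) * q = p" using p by (simp add: q_eq)
  \<comment> \<open>Layer cake: |F|^q is the integral of q * s^(q - 1) over 0 < s \<le> |F|.\<close>
  have "(\<integral>\<^sup>+x. ennreal (cmod (fourier g x) powr q) \<partial>lborel) =
      (\<integral>\<^sup>+x. (\<integral>\<^sup>+s. ennreal (q * s powr (q - 1)) * (indicator {0<..} s * indicator {s..} (cmod (fourier g x))) \<partial>lborel) \<partial>lborel)"
  proof (intro nn_integral_cong)
    fix x
    have "(\<integral>\<^sup>+s. ennreal (q * s powr (q - 1)) * (indicator {0<..} s * indicator {s..} (cmod (fourier g x))) \<partial>lborel) =
        (\<integral>\<^sup>+s. ennreal q * (ennreal (s powr (q - 1)) * indicator {0<..cmod (fourier g x)} s) \<partial>lborel)"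
      using q2 by (intro nn_integral_cong) (auto simp: indicator_def ennreal_mult)
    also have "\<dots> = ennreal q * (\<integral>\<^sup>+s. ennreal (s powr (q - 1)) * indicator {0<..cmod (fourier g x)} s \<partial>lborel)"
      by (intro nn_integral_cmult) measurable
    also have "\<dots> = ennreal q * ennreal (cmod (fourier g x) powr q / q)"
      using q2 by (subst nn_integral_powr_from_0) auto
    also have "\<dots> = ennreal (cmod (fourier g x) powr q)"
      using q2 by (simp flip: ennreal_mult)
    finally show "ennreal (cmod (fourier g x) powr q) =
      (\<integral>\<^sup>+s. ennreal (q * s powr (q - 1)) * (indicator {0<..} s * indicator {s..} (cmod (fourier g x))) \<partial>lborel)"
      by simp
  qed
  also have "\<dots> = (\<integral>\<^sup>+s. (\<integral>\<^sup>+x. ennreal (q * s powr (q - 1)) * (indicator {0<..} s * indicator {s..} (cmod (fourier g x))) \<partial>lborel) \<partial>lborel)"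
    unfolding indicator_def atLeast_iff greaterThan_iff by (rule lborel_pair.Fubini'[symmetric]) measurable
  also have "\<dots> = (\<integral>\<^sup>+s. ennreal (q * s powr (q - 1)) * indicator {0<..} s * (\<integral>\<^sup>+x. indicator {s..} (cmod (fourier g x)) \<partial>lborel) \<partial>lborel)"
    unfolding mult.assoc[symmetric] by (intro nn_integral_cong nn_integral_cmult) measurable
  also have "\<dots> \<le> (\<integral>\<^sup>+s. ennreal (q * s powr (q - 1)) * indicator {0<..} s *
     (\<integral>\<^sup>+x. ennreal (4 / s\<^sup>2) * (ennreal ((cmod (g x))\<^sup>2) * indicator {..2 * A} (s * cmod (g x) powr (p - 1))) \<partial>lborel) \<partial>lborel)"
  proof (intro nn_integral_mono)
    fix s :: real
    show "ennreal (q * s powr (q - 1)) * indicator {0<..} s * (\<integral>\<^sup>+x. indicator {s..} (cmod (fourier g x)) \<partial>lborel) \<le>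
      ennreal (q * s powr (q - 1)) * indicator {0<..} s *
     (\<integral>\<^sup>+x. ennreal (4 / s\<^sup>2) * (ennreal ((cmod (g x))\<^sup>2) * indicator {..2 * A} (s * cmod (g x) powr (p - 1))) \<partial>lborel)"
    proof (cases "s > 0")
      case True
      then show ?thesis by (intro mult_left_mono fourier_level_set_le[OF g gp A A_pos]) auto
    qed auto
  qed
  also have "\<dots> = (\<integral>\<^sup>+s. (\<integral>\<^sup>+x. ennreal (q * s powr (q - 1)) * indicator {0<..} s *
     (ennreal (4 / s\<^sup>2) * (ennreal ((cmod (g x))\<^sup>2) * indicator {..2 * A} (s * cmod (g x) powr (p - 1)))) \<partial>lborel) \<partial>lborel)"
    by (intro nn_integral_cong nn_integral_cmult[symmetric]) measurable
  also have "\<dots> = (\<integral>\<^sup>+x. (\<integral>\<^sup>+s. ennreal (q * s powr (q - 1)) * indicator {0<..} s *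
     (ennreal (4 / s\<^sup>2) * (ennreal ((cmod (g x))\<^sup>2) * indicator {..2 * A} (s * cmod (g x) powr (p - 1)))) \<partial>lborel) \<partial>lborel)"
    by (rule lborel_pair.Fubini') measurable
  also have "\<dots> = (\<integral>\<^sup>+x. ennreal (4 * q * (2 * A) powr (q - 2) / (q - 2)) * ennreal (cmod (g x) powr p) \<partial>lborel)"
  proof (intro nn_integral_cong)
    fix x
    show "(\<integral>\<^sup>+s. ennreal (q * s powr (q - 1)) * indicator {0<..} s *
     (ennreal (4 / s\<^sup>2) * (ennreal ((cmod (g x))\<^sup>2) * indicator {..2 * A} (s * cmod (g x) powr (p - 1)))) \<partial>lborel) =
     ennreal (4 * q * (2 * A) powr (q - 2) / (q - 2)) * ennreal (cmod (g x) powr p)"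
    proof (cases "g x = 0")
      case True
      then show ?thesis by simp
    next
      case False
      define r where "r = cmod (g x)"
      have r: "r > 0" using False by (simp add: r_def)
      \<comment> \<open>The solution s of s * r^(p - 1) = 2 * A, the largest level at which a value
        of modulus \<open>r\<close> survives the truncation.\<close>
      define \<Lambda> where "\<Lambda> = 2 * A * r powr (1 - p)"
      have \<Lambda>: "\<Lambda> > 0" using A_pos r by (simp add: \<Lambda>_def)
      have "(\<integral>\<^sup>+s. ennreal (q * s powr (q - 1)) * indicator {0<..} s *
          (ennreal (4 / s\<^sup>2) * (ennreal (r\<^sup>2) * indicator {..2 * A} (s * r powr (p - 1)))) \<partial>lborel) =
        (\<integral>\<^sup>+s. ennreal (4 * q * r\<^sup>2) * (ennreal (s powr (q - 3)) * indicator {0<..\<Lambda>} s) \<partial>lborel)"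
      proof (intro nn_integral_cong)
        fix s :: real
        show "ennreal (q * s powr (q - 1)) * indicator {0<..} s *
          (ennreal (4 / s\<^sup>2) * (ennreal (r\<^sup>2) * indicator {..2 * A} (s * r powr (p - 1)))) =
          ennreal (4 * q * r\<^sup>2) * (ennreal (s powr (q - 3)) * indicator {0<..\<Lambda>} s)"
        proof (cases "s > 0")
          case True
          have "s * r powr (p - 1) \<le> 2 * A \<longleftrightarrow> s \<le> \<Lambda>"
            using r by (simp add: \<Lambda>_def powr_diff field_simps)
          moreover have "s powr (q - 1) = s\<^sup>2 * s powr (q - 3)"
            using True by (simp flip: powr_numeral powr_add)
          ultimately show ?thesis
            using True q2 by (auto simp: indicator_def simp flip: ennreal_mult)
        qed auto
      qed
      also have "\<dots> = ennreal (4 * q * r\<^sup>2) * (\<integral>\<^sup>+s. (ennreal (s powr (q - 3)) * indicator {0<..\<Lambda>} s) \<partial>lborel)"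
        by (intro nn_integral_cmult) measurable
      also have "\<dots> = ennreal (4 * q * r\<^sup>2) * ennreal (\<Lambda> powr (q - 2) / (q - 2))"
        using q2 \<Lambda> by (subst nn_integral_powr_from_0) auto
      also have "\<dots> = ennreal (4 * q * r\<^sup>2 * (\<Lambda> powr (q - 2) / (q - 2)))"
        using q2 by (simp flip: ennreal_mult)
      also have "\<Lambda> powr (q - 2) = (2 * A) powr (q - 2) * r powr ((1 - p) * (q - 2))"
        using A_pos by (simp add: \<Lambda>_def powr_mult powr_powr)
      also have "r powr ((1 - p) * (q - 2)) = r powr p / r\<^sup>2"
      proof -
        \<comment> \<open>This identity, from (p - 1) * q = p, is what makes r^2 and the power of
          \<Lambda> combine to exactly r^p.\<close>
        have "(1 - p) * (q - 2) = p - 2" using pq by (simp add: algebra_simps)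
        then show ?thesis using r by (simp add: powr_diff powr_numeral)
      qed
      also have "4 * q * r\<^sup>2 * ((2 * A) powr (q - 2) * (r powr p / r\<^sup>2) / (q - 2)) = 4 * q * (2 * A) powr (q - 2) / (q - 2) * r powr p"
        using r by simp
      also have "ennreal \<dots> = ennreal (4 * q * (2 * A) powr (q - 2) / (q - 2)) * ennreal (r powr p)"
        using q2 by (intro ennreal_mult) auto
      finally show ?thesis by (simp add: r_def)
    qed
  qed
  also have "\<dots> = ennreal (4 * q * (2 * A) powr (q - 2) / (q - 2)) * ennreal A"
    using gp by (subst nn_integral_cmult) (auto simp: A nn_integral_eq_integral)
  also have "\<dots> = ennreal (4 * q * 2 powr (q - 2) / (q - 2) * A powr (q - 1))"
  proof -
    have "A powr (q - 1) = A powr (q - 2) * A" using powr_mult_base[of A "q - 2"] A_pos by (simp add: mult.commute)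
    then show ?thesis
      using q2 A_pos by (simp add: powr_mult flip: ennreal_mult)
  qed
  finally show ?thesis .
qed

section \<open>Extended powers, conjugate exponents and the norm form of Hausdorff-Young\<close>

lemma ennpowr_ennreal: "x \<ge> 0 \<Longrightarrow> ennpowr (ennreal x) r = ennreal (x powr r)"
  by (simp add: ennpowr_def)

lemma ennpowr_ennpowr: "ennpowr (ennpowr t r) s = ennpowr t (r * s)"
  by (simp add: ennpowr_def powr_powr)

lemma ennpowr_one [simp]: "ennpowr t 1 = t"
  by (cases t) (auto simp: ennpowr_def)

lemma ennpowr_mono: "t \<le> u \<Longrightarrow> r \<ge> 0 \<Longrightarrow> ennpowr t r \<le> ennpowr u r"
  by (auto simp: ennpowr_def top_unique less_top intro!: ennreal_leI powr_mono2 enn2real_mono)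

lemma conjugate_exponentE:
  assumes p: "1 \<le> p" and p': "1 / ennreal p + 1 / p' = 1"
  obtains "p = 1" "p' = \<infinity>" | q where "1 < p" "1 < q" "1 / p + 1 / q = 1" "p' = ennreal q"
proof (cases p')
  case (real q)
  \<comment> \<open>In \<open>ennreal\<close>, 1 / 0 is infinite, which would contradict the
    conjugacy equation.\<close>
  have "q \<noteq> 0" using p' real by auto
  then have q: "q > 0" using real by auto
  have "1 / ennreal p = ennreal (1 / p)" "1 / ennreal q = ennreal (1 / q)"
    using p q divide_ennreal[of 1] by simp_all
  then have "ennreal (1 / p + 1 / q) = ennreal 1"
    using p' p q by (simp add: real)
  then have eq: "1 / p + 1 / q = 1"
    using p q by (subst (asm) ennreal_inj) auto
  moreover have "1 / p > 0" "1 / q > 0" using p q by auto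
  ultimately have "1 / p < 1" "1 / q < 1" by linarith+
  then have "p \<noteq> 1" "q > 1" using q by auto
  with that(2) eq p real show ?thesis by auto
next
  case top
  then have "ennreal (1 / p) = ennreal 1"
    using p' p by (simp flip: divide_ennreal)
  then have "p = 1" using p by (subst (asm) ennreal_inj) auto
  with that(1) top show ?thesis by auto
qed

lemma completion_ex_borel_measurable_complex:
  fixes g :: "'a \<Rightarrow> complex"
  assumes [measurable]: "g \<in> borel_measurable (completion M)"
  obtains g' where "g' \<in> borel_measurable M" "AE x in M. g x = g' x"
proof -
  have "(\<lambda>x. Re (g x)) \<in> borel_measurable (completion M)" "(\<lambda>x. Im (g x)) \<in> borel_measurable (completion M)"
    by measurable
  then obtain r i where [measurable]: "r \<in> borel_measurable M" "i \<in> borel_measurable M"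
    and ae: "AE x in M. Re (g x) = r x" "AE x in M. Im (g x) = i x"
    using completion_ex_borel_measurable_real by metis
  show thesis
  proof
    show "(\<lambda>x. Complex (r x) (i x)) \<in> borel_measurable M"
      unfolding Complex_eq by measurable
    show "AE x in M. g x = Complex (r x) (i x)"
      using ae by eventually_elim (simp add: complex_eq_iff)
  qed
qed

lemma hausdorff_young:
  assumes p: "1 \<le> p" "p \<le> 2" and p': "1 / ennreal p + 1 / p' = 1"
  shows "\<exists>C::real. C > 0 \<and> (\<forall>g::'a::euclidean_space \<Rightarrow> complex. integrable lebesgue g \<longrightarrow>
    ennpowr (Lp_norm p' (fourier g)) p \<le> ennreal C * (\<integral>\<^sup>+x. ennreal (cmod (g x) powr p) \<partial>lebesgue))"
proof -
  \<comment> \<open>The analytic work takes place on \<open>lborel\<close>; a Borel representative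
    carries it over to \<open>lebesgue\<close> at the end.\<close>
  have borel: "\<exists>C::real. C > 0 \<and> (\<forall>g::'a \<Rightarrow> complex. integrable lborel g \<longrightarrow>
    ennpowr (Lp_norm p' (fourier g)) p \<le> ennreal C * (\<integral>\<^sup>+x. ennreal (cmod (g x) powr p) \<partial>lborel))"
    using p(1) p'
  proof (cases rule: conjugate_exponentE)
    case 1
    have "Lp_norm p' (fourier g) \<le> (\<integral>\<^sup>+x. ennreal (cmod (g x)) \<partial>lborel)" if "integrable lborel g" for g :: "'a \<Rightarrow> complex"
    proof -
      have [measurable]: "g \<in> borel_measurable borel" using that by auto
      have "(\<lambda>x. ennreal (cmod (fourier g x))) \<in> borel_measurable lebesgue"
        by (rule measurable_completion) measurable
      then show ?thesis
        unfolding 1 Lp_norm_def by (auto intro!: esssup_I norm_fourier_le)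
    qed
    then show ?thesis
      by (intro exI[of _ 1]) (simp add: 1)
  next
    case (2 q)
    have norm_eq: "ennpowr (Lp_norm p' (fourier g)) p = ennpowr (\<integral>\<^sup>+x. ennreal (cmod (fourier g x) powr q) \<partial>lborel) (p / q)"
      for g :: "'a \<Rightarrow> complex"
      using 2 by (simp add: Lp_norm_def ennpowr_ennpowr nn_integral_completion)
    have "\<exists>c. c > 0 \<and> (\<forall>g::'a \<Rightarrow> complex. \<forall>A. integrable lborel g \<longrightarrow> integrable lborel (\<lambda>x. cmod (g x) powr p) \<longrightarrow>
       A = (LINT x|lborel. cmod (g x) powr p) \<longrightarrow>
       (\<integral>\<^sup>+x. ennreal (cmod (fourier g x) powr q) \<partial>lborel) \<le> ennreal (c * A powr (q - 1)))"
    \<comment> \<open>The interpolation constant has q - 2 in its denominator, so the endpoint is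
      taken from Plancherel with constant 1.\<close>
    proof (cases "p = 2")
      case True
      then have q2: "q = 2" using 2 by (simp add: field_simps)
      have "(\<integral>\<^sup>+x. ennreal (cmod (fourier g x) powr q) \<partial>lborel) \<le> ennreal (1 * A powr (q - 1))"
        if g: "integrable lborel g" and gp: "integrable lborel (\<lambda>x. cmod (g x) powr p)"
        and A: "A = (LINT x|lborel. cmod (g x) powr p)" for g :: "'a \<Rightarrow> complex" and A
      proof -
        have "(\<integral>\<^sup>+x. ennreal ((cmod (g x))\<^sup>2) \<partial>lborel) = ennreal A"
          using gp A unfolding True by (subst nn_integral_eq_integral) (auto simp: powr_numeral)
        moreover have "A \<ge> 0" using A by (simp add: integral_nonneg)
        ultimately show ?thesis
          using nn_integral_fourier_square_le[OF g] by (simp add: q2 powr_numeral)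
      qed
      then show ?thesis by (intro exI[of _ 1]) simp
    next
      case False
      then have "p < 2" using p by simp
      moreover have "q > 2"
      proof -
        have "p * (q - 1) = q" using 2 by (simp add: field_simps)
        moreover have "p * (q - 1) < 2 * (q - 1)" using 2 \<open>p < 2\<close> by (intro mult_strict_right_mono) auto
        ultimately show ?thesis by simp
      qed
      ultimately show ?thesis
        using nn_integral_fourier_powr_le[OF _ _ \<open>1 < p\<close> _ \<open>1 / p + 1 / q = 1\<close>]
        by (intro exI[of _ "4 * q * 2 powr (q - 2) / (q - 2)"]) auto
    qed
    then obtain c where c: "c > 0" and bound: "\<And>g A. integrable lborel g \<Longrightarrow> integrable lborel (\<lambda>x::'a. cmod (g x) powr p) \<Longrightarrow>
       A = (LINT x|lborel. cmod (g x) powr p) \<Longrightarrow>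
       (\<integral>\<^sup>+x. ennreal (cmod (fourier g x) powr q) \<partial>lborel) \<le> ennreal (c * A powr (q - 1))"
      by blast
    have "ennpowr (Lp_norm p' (fourier g)) p \<le> ennreal (c powr (p / q)) * (\<integral>\<^sup>+x. ennreal (cmod (g x) powr p) \<partial>lborel)"
      if g: "integrable lborel g" for g :: "'a \<Rightarrow> complex"
    proof (cases "(\<integral>\<^sup>+x. ennreal (cmod (g x) powr p) \<partial>lborel) = \<infinity>")
      case True
      then show ?thesis using c by (simp add: ennreal_mult_top)
    next
      case False
      have [measurable]: "g \<in> borel_measurable borel" using g by auto
      define A where "A = (LINT x|lborel. cmod (g x) powr p)"
      have gp: "integrable lborel (\<lambda>x. cmod (g x) powr p)"
        using False by (intro integrableI_bounded) (auto simp: less_top)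
      have "A \<ge> 0" by (simp add: A_def integral_nonneg)
      \<comment> \<open>Passing from the integral of the q-th power to the p-th power of the norm
        raises to p / q; conjugacy then makes the bound linear in \<open>A\<close>.\<close>
      have "(q - 1) * (p / q) = 1"
        using 2 by (simp add: field_simps)
      then have "(c * A powr (q - 1)) powr (p / q) = c powr (p / q) * A"
        using c \<open>A \<ge> 0\<close> by (simp add: powr_mult powr_powr)
      then have "ennpowr (ennreal (c * A powr (q - 1))) (p / q) = ennreal (c powr (p / q)) * ennreal A"
        using c \<open>A \<ge> 0\<close> by (simp add: ennpowr_ennreal flip: ennreal_mult)
      moreover have "(\<integral>\<^sup>+x. ennreal (cmod (g x) powr p) \<partial>lborel) = ennreal A"
        unfolding A_def using gp by (intro nn_integral_eq_integral) auto
      ultimately show ?thesis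
        unfolding norm_eq using ennpowr_mono[OF bound[OF g gp A_def], of "p / q"] 2 by simp
    qed
    then show ?thesis using c by (intro exI[of _ "c powr (p / q)"]) auto
  qed
  then obtain C where C: "C > 0" and bound: "\<And>g::'a \<Rightarrow> complex. integrable lborel g \<Longrightarrow>
    ennpowr (Lp_norm p' (fourier g)) p \<le> ennreal C * (\<integral>\<^sup>+x. ennreal (cmod (g x) powr p) \<partial>lborel)"
    by blast
  have "ennpowr (Lp_norm p' (fourier g)) p \<le> ennreal C * (\<integral>\<^sup>+x. ennreal (cmod (g x) powr p) \<partial>lebesgue)"
    if g: "integrable lebesgue g" for g :: "'a \<Rightarrow> complex"
  proof -
    \<comment> \<open>Changing \<open>g\<close> on a null set alters neither its transform at any
      point nor the integral on the right.\<close>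
    obtain h where h[measurable]: "h \<in> borel_measurable lborel" and ae: "AE x in lborel. g x = h x"
      using completion_ex_borel_measurable_complex[of g lborel] g by auto
    have h': "h \<in> borel_measurable lebesgue" using h by (rule measurable_completion)
    have ae': "AE x in lebesgue. g x = h x" using ae by (rule AE_completion)
    have "integrable lebesgue h"
      using integrable_cong_AE[OF borel_measurable_integrable[OF g] h' ae'] g by simp
    then have h_int: "integrable lborel h"
      using integrable_completion[OF h] by simp
    have "fourier g = fourier h"
    proof
      fix \<xi> :: 'a
      have ch: "(\<lambda>x::'a. character x \<xi>) \<in> borel_measurable lebesgue"
        by (rule measurable_completion) measurable
      have gm: "g \<in> borel_measurable lebesgue" using g by auto
      have "(LINT x|lebesgue. g x * character x \<xi>) = (LINT x|lebesgue. h x * character x \<xi>)"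
        by (rule integral_cong_AE[OF borel_measurable_times[OF gm ch] borel_measurable_times[OF h' ch]])
          (use ae' in auto)
      then show "fourier g \<xi> = fourier h \<xi>" by (simp add: fourier_def character_def)
    qed
    moreover have "(\<integral>\<^sup>+x. ennreal (cmod (g x) powr p) \<partial>lebesgue) = (\<integral>\<^sup>+x. ennreal (cmod (h x) powr p) \<partial>lborel)"
      unfolding nn_integral_completion using ae by (intro nn_integral_cong_AE) auto
    ultimately show ?thesis using bound[OF h_int] by simp
  qed
  with C show ?thesis by blast
qed

section \<open>Fourier transforms of Schwartz functions\<close>

lemma integral_lborel_translate:
  fixes f :: "'a::euclidean_space \<Rightarrow> 'b::{banach, second_countable_topology}"
  assumes [measurable]: "f \<in> borel_measurable borel"
  shows "(LINT x|lborel. f (x + c)) = integral\<^sup>L lborel f"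
  by (subst (2) lborel_distr_plus[of c, symmetric]) (simp add: integral_distr add.commute)

lemma integrable_lborel_translate:
  fixes f :: "'a::euclidean_space \<Rightarrow> 'b::{banach, second_countable_topology}"
  assumes "integrable lborel f"
  shows "integrable lborel (\<lambda>x. f (x + c))"
proof -
  have "f \<in> borel_measurable borel" using assms by auto
  with assms show ?thesis
    by (subst (asm) lborel_distr_plus[of c, symmetric]) (simp add: integrable_distr_eq add.commute)
qed

text \<open>The mean value inequality for the one-variable function s \<mapsto> h (x + s b), so that
  only the derivative in direction \<open>b\<close> enters.\<close>

lemma norm_diff_le_directional:
  fixes h :: "'a::euclidean_space \<Rightarrow> complex"
  assumes diff: "h differentiable_on UNIV" and t: "t \<ge> 0"
    and B: "\<And>s. 0 \<le> s \<Longrightarrow> s \<le> t \<Longrightarrow> cmod (frechet_derivative h (at (x + s *\<^sub>R b)) b) \<le> B"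
  shows "cmod (h (x + t *\<^sub>R b) - h x) \<le> B * t"
proof -
  have deriv: "((\<lambda>s. h (x + s *\<^sub>R b)) has_derivative (\<lambda>r. r *\<^sub>R frechet_derivative h (at (x + s *\<^sub>R b)) b)) (at s within {0..t})" for s
  proof -
    have h: "(h has_derivative frechet_derivative h (at (x + s *\<^sub>R b))) (at (x + s *\<^sub>R b))"
      using diff by (simp add: differentiable_on_def frechet_derivative_works)
    have "((\<lambda>s. x + s *\<^sub>R b) has_derivative (\<lambda>r. r *\<^sub>R b)) (at s)"
      by (auto intro!: derivative_eq_intros)
    from diff_chain_at[OF this h] have "((\<lambda>s. h (x + s *\<^sub>R b)) has_derivative (\<lambda>r. frechet_derivative h (at (x + s *\<^sub>R b)) (r *\<^sub>R b))) (at s)"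
      by (simp add: comp_def)
    moreover have "frechet_derivative h (at (x + s *\<^sub>R b)) (r *\<^sub>R b) = r *\<^sub>R frechet_derivative h (at (x + s *\<^sub>R b)) b" for r
      using has_derivative_linear[OF h] by (rule linear_scale)
    ultimately show ?thesis
      by (simp add: has_derivative_at_withinI)
  qed
  have "cmod (h (x + t *\<^sub>R b) - h (x + 0 *\<^sub>R b)) \<le> B * norm (t - 0)"
    by (rule differentiable_bound[OF convex_real_interval(5) deriv onorm_le])
       (use t B in \<open>auto simp: mult.commute[of B] intro!: mult_left_mono\<close>)
  then show ?thesis using t by simp
qed

text \<open>Instead of integrating by parts, transform the difference quotients of \<open>h\<close>:
  translation turns them into difference quotients of an exponential times \<open>fourier h\<close>,
  and dominated convergence passes to the limit on the other side.\<close>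

lemma fourier_frechet_derivative:
  fixes h :: "'a::euclidean_space \<Rightarrow> complex"
  defines "w \<equiv> \<lambda>x::'a. inverse ((1 + norm x) ^ (2 * DIM('a)))"
  assumes diff: "h differentiable_on UNIV" and D: "D = (\<lambda>x. frechet_derivative h (at x) b)"
    and D_m: "D \<in> borel_measurable borel" and b: "norm b = 1"
    and h_le: "\<And>x. cmod (h x) \<le> c * w x" and D_le: "\<And>x. cmod (D x) \<le> c * w x"
  shows "fourier D \<xi> = 2 * of_real pi * \<i> * of_real (b \<bullet> \<xi>) * fourier h \<xi>"
proof -
  have w_pos: "w x > 0" for x by (simp add: w_def add_pos_nonneg)
  have w_int: "integrable lborel w" unfolding w_def by (rule integrable_inverse_power_norm)
  have c: "c \<ge> 0" using h_le[of 0] w_pos[of 0] norm_ge_zero[of "h 0"] by (meson order_trans zero_le_mult_iff not_le)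
  \<comment> \<open>The weight varies by a bounded factor on unit balls. Since the steps
    \<open>\<tau> n\<close> are at most 1, one integrable function dominates all the
    quotients.\<close>
  have w_shift: "w y \<le> 2 ^ (2 * DIM('a)) * w x" if "norm (y - x) \<le> 1" for x y
  proof -
    have "1 + norm x \<le> 2 * (1 + norm y)"
      using norm_triangle_ineq3[of x y] that by (simp add: norm_minus_commute) (smt (verit) norm_ge_zero)
    then have "(1 + norm x) ^ (2 * DIM('a)) \<le> (2 * (1 + norm y)) ^ (2 * DIM('a))"
      by (intro power_mono) auto
    then have "(1 + norm x) ^ (2 * DIM('a)) \<le> 2 ^ (2 * DIM('a)) * (1 + norm y) ^ (2 * DIM('a))"
      by (simp only: power_mult_distrib)
    moreover have "(1 + norm x) ^ (2 * DIM('a)) > 0" "(1 + norm y) ^ (2 * DIM('a)) > 0"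
      by (simp_all add: add_pos_nonneg)
    ultimately show ?thesis
      unfolding w_def by (simp add: field_simps)
  qed
  have h_m[measurable]: "h \<in> borel_measurable borel"
    using differentiable_imp_continuous_on[OF diff] by (rule borel_measurable_continuous_onI)
  have h_int: "integrable lborel h"
    by (rule Bochner_Integration.integrable_bound[of _ "\<lambda>x. c * w x"])
      (use h_le w_int in \<open>auto intro: order_trans[OF _ abs_ge_self]\<close>)
  define \<tau> :: "nat \<Rightarrow> real" where "\<tau> n = inverse (real (Suc n))" for n
  have \<tau>_pos: "\<tau> n > 0" and \<tau>_le: "\<tau> n \<le> 1" for n
    by (simp_all add: \<tau>_def inverse_le_1_iff)
  have \<tau>_lim: "\<tau> \<longlonglongrightarrow> 0" unfolding \<tau>_def[abs_def] by (rule LIMSEQ_inverse_real_of_nat)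
  define q where "q n x = (h (x + \<tau> n *\<^sub>R b) - h x) /\<^sub>R \<tau> n" for n x
  have q_m[measurable]: "q n \<in> borel_measurable borel" for n unfolding q_def[abs_def] by measurable
  have q_lim: "(\<lambda>n. q n x) \<longlonglongrightarrow> D x" for x
  proof -
    have "(h has_derivative frechet_derivative h (at x)) (at x)"
      using diff by (simp add: differentiable_on_def frechet_derivative_works)
    then have lin: "linear (frechet_derivative h (at x))"
      and lim: "(\<lambda>y. norm (h (x + y) - h x - frechet_derivative h (at x) y) / norm y) \<midarrow>0\<rightarrow> 0"
      by (auto simp: has_derivative_at has_derivative_linear bounded_linear.linear)
    have "filterlim (\<lambda>n. \<tau> n *\<^sub>R b) (at 0) sequentially"
      unfolding filterlim_at using \<tau>_lim \<tau>_pos b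
      by (auto intro!: tendsto_eq_intros simp: less_le)
    from filterlim_compose[OF lim this]
    have "(\<lambda>n. norm (h (x + \<tau> n *\<^sub>R b) - h x - frechet_derivative h (at x) (\<tau> n *\<^sub>R b)) / norm (\<tau> n *\<^sub>R b)) \<longlonglongrightarrow> 0" .
    moreover have "norm (h (x + \<tau> n *\<^sub>R b) - h x - frechet_derivative h (at x) (\<tau> n *\<^sub>R b)) / norm (\<tau> n *\<^sub>R b) = norm (q n x - D x)" for n
    proof -
      have "q n x - D x = (h (x + \<tau> n *\<^sub>R b) - h x - frechet_derivative h (at x) (\<tau> n *\<^sub>R b)) /\<^sub>R \<tau> n"
        using \<tau>_pos[of n] by (simp add: q_def D linear_scale[OF lin] scaleR_diff_right)
      then show ?thesis using \<tau>_pos[of n] b by (simp add: divide_inverse mult.commute)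
    qed
    ultimately have "(\<lambda>n. norm (q n x - D x)) \<longlonglongrightarrow> 0" by simp
    then show ?thesis using Lim_null tendsto_norm_zero_iff by blast
  qed
  have q_le: "cmod (q n x) \<le> c * (2 ^ (2 * DIM('a)) * w x)" for n x
  proof -
    have "cmod (h (x + \<tau> n *\<^sub>R b) - h x) \<le> (c * (2 ^ (2 * DIM('a)) * w x)) * \<tau> n"
    proof (rule norm_diff_le_directional[OF diff])
      fix s assume s: "0 \<le> s" "s \<le> \<tau> n"
      have "cmod (D (x + s *\<^sub>R b)) \<le> c * w (x + s *\<^sub>R b)" by (rule D_le)
      also have "\<dots> \<le> c * (2 ^ (2 * DIM('a)) * w x)"
        using s \<tau>_le[of n] b by (intro mult_left_mono w_shift c) auto
      finally show "cmod (frechet_derivative h (at (x + s *\<^sub>R b)) b) \<le> c * (2 ^ (2 * DIM('a)) * w x)"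
        by (simp add: D)
    qed (use \<tau>_pos[of n] in simp)
    then show ?thesis using \<tau>_pos[of n] by (simp add: q_def norm_divide pos_divide_le_eq divide_inverse_commute[symmetric] del: scaleR_diff_right)
  qed
  have lim_q: "(\<lambda>n. LINT x|lborel. q n x * character x \<xi>) \<longlonglongrightarrow> (LINT x|lborel. D x * character x \<xi>)"
  proof (rule integral_dominated_convergence)
    show "integrable lborel (\<lambda>x. c * (2 ^ (2 * DIM('a)) * w x))" using w_int by simp
    show "AE x in lborel. (\<lambda>n. q n x * character x \<xi>) \<longlonglongrightarrow> D x * character x \<xi>"
      by (intro AE_I2 tendsto_intros q_lim)
    show "AE x in lborel. cmod (q n x * character x \<xi>) \<le> c * (2 ^ (2 * DIM('a)) * w x)" for n
      using q_le by (simp add: norm_mult)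
  qed (use D_m in measurable)
  have fourier_q: "(LINT x|lborel. q n x * character x \<xi>) = (character (- (\<tau> n *\<^sub>R b)) \<xi> - 1) / of_real (\<tau> n) * fourier h \<xi>" for n
  proof -
    \<comment> \<open>Shifting the character along with \<open>h\<close> leaves a constant phase, so
      translation invariance applies to the rest.\<close>
    have eq: "h (x + \<tau> n *\<^sub>R b) * character x \<xi> = h (x + \<tau> n *\<^sub>R b) * character (x + \<tau> n *\<^sub>R b) \<xi> * character (- (\<tau> n *\<^sub>R b)) \<xi>" for x
    proof -
      have "character x \<xi> = character ((x + \<tau> n *\<^sub>R b) + (- (\<tau> n *\<^sub>R b))) \<xi>" by simp
      then show ?thesis by (simp only: character_add_left mult.assoc)
    qed
    have sh: "integrable lborel (\<lambda>x. h (x + \<tau> n *\<^sub>R b) * character (x + \<tau> n *\<^sub>R b) \<xi>)"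
      using integrable_lborel_translate[OF integrable_mult_character[OF h_int]] .
    have "(LINT x|lborel. q n x * character x \<xi>) =
        (LINT x|lborel. (h (x + \<tau> n *\<^sub>R b) * character (x + \<tau> n *\<^sub>R b) \<xi> * character (- (\<tau> n *\<^sub>R b)) \<xi> - h x * character x \<xi>) / of_real (\<tau> n))"
      unfolding q_def eq[symmetric]
      by (intro Bochner_Integration.integral_cong refl) (simp add: scaleR_conv_of_real field_simps)
    also have "\<dots> = ((LINT x|lborel. h (x + \<tau> n *\<^sub>R b) * character (x + \<tau> n *\<^sub>R b) \<xi>) * character (- (\<tau> n *\<^sub>R b)) \<xi> - fourier h \<xi>) / of_real (\<tau> n)"
      using sh integrable_mult_character[OF h_int] by (simp add: fourier_lborel)
    also have "(LINT x|lborel. h (x + \<tau> n *\<^sub>R b) * character (x + \<tau> n *\<^sub>R b) \<xi>) = fourier h \<xi>"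
      using integral_lborel_translate[of "\<lambda>x. h x * character x \<xi>"] by (simp add: fourier_lborel)
    finally show ?thesis by (simp add: field_simps)
  qed
  have "(\<lambda>n. (character (- (\<tau> n *\<^sub>R b)) \<xi> - 1) / of_real (\<tau> n) * fourier h \<xi>) \<longlonglongrightarrow>
      2 * of_real pi * \<i> * of_real (b \<bullet> \<xi>) * fourier h \<xi>"
  proof -
    let ?z = "2 * of_real pi * \<i> * of_real (b \<bullet> \<xi>)"
    \<comment> \<open>The limit of the phase quotients is the derivative at 0 of u \<mapsto> exp (u
      * ?z).\<close>
    have "((\<lambda>u. exp (u * ?z)) has_field_derivative ?z) (at 0)"
      by (auto intro!: derivative_eq_intros)
    then have lim: "(\<lambda>u. (exp (u * ?z) - 1) / u) \<midarrow>0\<rightarrow> ?z"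
      by (simp add: DERIV_def)
    have "filterlim (\<lambda>n. complex_of_real (\<tau> n)) (at 0) sequentially"
      unfolding filterlim_at using \<tau>_lim \<tau>_pos
      by (auto intro!: tendsto_eq_intros simp: less_le)
    from filterlim_compose[OF lim this]
    have "(\<lambda>n. (exp (of_real (\<tau> n) * ?z) - 1) / of_real (\<tau> n)) \<longlonglongrightarrow> ?z" .
    moreover have "exp (of_real (\<tau> n) * ?z) = character (- (\<tau> n *\<^sub>R b)) \<xi>" for n
      by (simp add: character_def mult_ac)
    ultimately show ?thesis by (intro tendsto_mult_right) simp
  qed
  from LIMSEQ_unique[OF lim_q[unfolded fourier_q] this] show ?thesis
    using D_m by (simp add: fourier_lborel)
qed

section \<open>Schwartz seminorms and the decay of Fourier transforms\<close>

text \<open>A real supremum is an upper bound only if the set is bounded above. It is: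
  \<open>Basis\<close> is finite, so there are finitely many lists of length at most
  \<open>m\<close>, each contributing a bounded family.\<close>

lemma schwartz_norm_bound:
  fixes g :: "'a::euclidean_space \<Rightarrow> complex"
  assumes g: "schwartz g" and bs: "bs \<in> lists Basis" "length bs \<le> m"
  shows "(1 + norm x) ^ m * cmod (iter_pd bs g x) \<le> schwartz_norm m g"
proof -
  let ?L = "{bs \<in> lists (Basis :: 'a set). length bs \<le> m}"
  let ?f = "\<lambda>(x, bs). (1 + norm x) ^ m * cmod (iter_pd bs g x)"
  have "finite ?L"
    using finite_lists_length_le[of "Basis :: 'a set" m] by (simp add: lists_eq_set)
  then have bounded: "bounded (\<Union>bs\<in>?L. range (\<lambda>x. (1 + norm x) ^ m * cmod (iter_pd bs g x)))"
    using g by (intro bounded_UN) (auto simp: schwartz_def)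
  have image: "?f ` (UNIV \<times> ?L) = (\<Union>bs\<in>?L. range (\<lambda>x. (1 + norm x) ^ m * cmod (iter_pd bs g x)))"
    by auto
  have "bdd_above (?f ` (UNIV \<times> ?L))"
    unfolding image using bounded by (rule bounded_imp_bdd_above)
  then have "?f (x, bs) \<le> (SUP z\<in>UNIV \<times> ?L. ?f z)"
    by (intro cSUP_upper) (use bs in auto)
  then show ?thesis by (simp add: schwartz_norm_def)
qed

lemma measurable_iter_pd_schwartz:
  fixes g :: "'a::euclidean_space \<Rightarrow> complex"
  assumes "schwartz g" "bs \<in> lists Basis"
  shows "iter_pd bs g \<in> borel_measurable borel"
proof (intro borel_measurable_continuous_onI differentiable_imp_continuous_on)
  show "iter_pd bs g differentiable_on UNIV"
    using assms by (simp add: schwartz_def)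
qed

lemma norm_iter_pd_le:
  fixes g :: "'a::euclidean_space \<Rightarrow> complex"
  assumes g: "schwartz g" and bs: "bs \<in> lists Basis" "length bs \<le> 2 * DIM('a)"
  shows "cmod (iter_pd bs g x) \<le> schwartz_norm (2 * DIM('a)) g * inverse ((1 + norm x) ^ (2 * DIM('a)))"
proof -
  have "(1 + norm x) ^ (2 * DIM('a)) > 0" by (simp add: add_pos_nonneg)
  with schwartz_norm_bound[OF assms, of x] show ?thesis by (simp add: field_simps)
qed

lemma integrable_iter_pd_schwartz:
  fixes g :: "'a::euclidean_space \<Rightarrow> complex"
  assumes g: "schwartz g" and bs: "bs \<in> lists Basis" "length bs \<le> 2 * DIM('a)"
  shows "integrable lborel (iter_pd bs g)"
proof (rule Bochner_Integration.integrable_bound)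
  show "integrable lborel (\<lambda>x::'a. schwartz_norm (2 * DIM('a)) g * inverse ((1 + norm x) ^ (2 * DIM('a))))"
    by (intro integrable_mult_right integrable_inverse_power_norm)
  show "AE x in lborel. cmod (iter_pd bs g x) \<le> norm (schwartz_norm (2 * DIM('a)) g * inverse ((1 + norm x) ^ (2 * DIM('a))))"
    unfolding real_norm_def by (intro AE_I2 order_trans[OF norm_iter_pd_le[OF assms] abs_ge_self])
qed (use measurable_iter_pd_schwartz[OF g bs(1)] in simp)

text \<open>The restriction on \<open>n\<close> lets one seminorm, of order twice the dimension,
  control all derivatives that occur.\<close>

lemma fourier_iter_pd:
  fixes g :: "'a::euclidean_space \<Rightarrow> complex"
  assumes g: "schwartz g" and b: "b \<in> Basis" and n: "n \<le> 2 * DIM('a)"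
  shows "fourier (iter_pd (replicate n b) g) \<xi> = (2 * of_real pi * \<i> * of_real (b \<bullet> \<xi>)) ^ n * fourier g \<xi>"
  using n
proof (induction n)
  case (Suc n)
  have bs: "replicate k b \<in> lists Basis" for k using b by (auto simp: lists_eq_set set_replicate_conv_if)
  have "fourier (iter_pd (replicate (Suc n) b) g) \<xi> = 2 * of_real pi * \<i> * of_real (b \<bullet> \<xi>) * fourier (iter_pd (replicate n b) g) \<xi>"
  proof (rule fourier_frechet_derivative)
    show "iter_pd (replicate n b) g differentiable_on UNIV"
      using g bs by (auto simp: schwartz_def)
    show "iter_pd (replicate (Suc n) b) g = (\<lambda>x. frechet_derivative (iter_pd (replicate n b) g) (at x) b)"
      by simp
    show "cmod (iter_pd (replicate n b) g x) \<le> schwartz_norm (2 * DIM('a)) g * inverse ((1 + norm x) ^ (2 * DIM('a)))" for x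
      using Suc.prems by (intro norm_iter_pd_le g bs) simp
    show "cmod (iter_pd (replicate (Suc n) b) g x) \<le> schwartz_norm (2 * DIM('a)) g * inverse ((1 + norm x) ^ (2 * DIM('a)))" for x
      using Suc.prems by (intro norm_iter_pd_le g bs) simp
    show "iter_pd (replicate (Suc n) b) g \<in> borel_measurable borel"
      by (intro measurable_iter_pd_schwartz g bs)
  qed (use b in simp)
  with Suc show ?case by simp
qed simp

text \<open>Differentiating repeatedly in the direction of the largest coordinate of \<xi>
  multiplies the transform by a power of that coordinate, which is comparable to a power of norm
  \<xi>. \<open>K\<close> depends on the dimension only, so the right side is one continuous
  seminorm of \<open>g\<close>.\<close>

lemma fourier_schwartz_decay:
  obtains K where "K \<ge> 0" and "\<And>g \<xi>. schwartz g \<Longrightarrow>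
    cmod (fourier g \<xi>) \<le> K * schwartz_norm (2 * DIM('a)) g * inverse ((1 + norm (\<xi>::'a::euclidean_space)) ^ (2 * DIM('a)))"
proof -
  let ?M = "2 * DIM('a)"
  define I where "I = (LINT x|lborel. inverse ((1 + norm (x::'a)) ^ ?M))"
  have I: "I \<ge> 0" unfolding I_def by (rule Bochner_Integration.integral_nonneg) simp
  have "cmod (fourier g \<xi>) \<le> (2 * DIM('a)) ^ ?M * (2 * I) * schwartz_norm ?M g * inverse ((1 + norm \<xi>) ^ ?M)"
    if g: "schwartz g" for g :: "'a \<Rightarrow> complex" and \<xi>
  proof -
    let ?S = "schwartz_norm ?M g"
    have F: "cmod (fourier (iter_pd bs g) \<xi>) \<le> ?S * I" if bs: "bs \<in> lists Basis" "length bs \<le> ?M" for bs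
    proof -
      have "cmod (fourier (iter_pd bs g) \<xi>) \<le> (LINT x|lborel. cmod (iter_pd bs g x))"
        using integral_norm_bound[of lborel "\<lambda>x. iter_pd bs g x * character x \<xi>"] measurable_iter_pd_schwartz[OF g bs(1)]
        by (simp add: fourier_lborel norm_mult)
      also have "\<dots> \<le> (LINT x|lborel. ?S * inverse ((1 + norm (x::'a)) ^ ?M))"
        by (intro integral_mono integrable_norm integrable_iter_pd_schwartz g bs norm_iter_pd_le
            integrable_mult_right integrable_inverse_power_norm)
      finally show ?thesis by (simp add: I_def)
    qed
    obtain b where b: "b \<in> Basis" and max: "\<And>b'. b' \<in> Basis \<Longrightarrow> \<bar>\<xi> \<bullet> b'\<bar> \<le> \<bar>\<xi> \<bullet> b\<bar>"
    proof -
      let ?A = "(\<lambda>b. \<bar>\<xi> \<bullet> b\<bar>) ` Basis"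
      have "Max ?A \<in> ?A" by (rule Max_in) auto
      then obtain b where "b \<in> Basis" "Max ?A = \<bar>\<xi> \<bullet> b\<bar>" by (rule imageE)
      then show thesis using that[of b] Max_ge[of ?A] by auto
    qed
    let ?a = "\<bar>\<xi> \<bullet> b\<bar>"
    have "norm \<xi> \<le> (\<Sum>b\<in>Basis. \<bar>\<xi> \<bullet> b\<bar>)" by (rule norm_le_l1)
    also have "\<dots> \<le> DIM('a) * ?a" using sum_bounded_above[of Basis "\<lambda>b. \<bar>\<xi> \<bullet> b\<bar>" ?a] max by simp
    finally have "1 + norm \<xi> \<le> real (2 * DIM('a)) * max 1 ?a"
    proof -
      assume "norm \<xi> \<le> DIM('a) * ?a"
      moreover have "DIM('a) * ?a \<le> DIM('a) * max 1 ?a" by (intro mult_left_mono) auto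
      moreover have "1 * 1 \<le> DIM('a) * max 1 ?a" by (intro mult_mono) (auto simp: Suc_le_eq)
      ultimately have "1 + norm \<xi> \<le> 2 * (DIM('a) * max 1 ?a)" by linarith
      then show ?thesis by (simp add: mult.assoc)
    qed
    then have "(1 + norm \<xi>) ^ ?M \<le> (real (2 * DIM('a)) * max 1 ?a) ^ ?M"
      by (intro power_mono) auto
    also have "\<dots> = (2 * DIM('a)) ^ ?M * max 1 ?a ^ ?M"
      unfolding power_mult_distrib[of "real (2 * DIM('a))"] by simp
    \<comment> \<open>The two summands match the two available bounds: the 1 belongs to the
      transform of \<open>g\<close> itself, the power to that of its iterated derivative. Hence the
      factor 2 before \<open>I\<close>.\<close>
    also have "\<dots> \<le> (2 * DIM('a)) ^ ?M * (1 + ?a ^ ?M)"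
      by (intro mult_left_mono) (auto simp: max_def)
    finally have "(1 + norm \<xi>) ^ ?M * cmod (fourier g \<xi>) \<le> (2 * DIM('a)) ^ ?M * (1 + ?a ^ ?M) * cmod (fourier g \<xi>)"
      by (intro mult_right_mono) auto
    also have "\<dots> \<le> (2 * DIM('a)) ^ ?M * (2 * (?S * I))"
    proof -
      have 1: "cmod (fourier g \<xi>) \<le> ?S * I" using F[of "[]"] by simp
      \<comment> \<open>The factors 2 * pi from differentiation exceed 1 and are only inserted to
        match the derivative formula.\<close>
      have "?a ^ ?M * cmod (fourier g \<xi>) \<le> (2 * pi * ?a) ^ ?M * cmod (fourier g \<xi>)"
        using pi_gt3 by (intro mult_right_mono power_mono) (auto intro!: mult_right_mono simp: mult_le_cancel_right1)
      also have "\<dots> = cmod (fourier (iter_pd (replicate ?M b) g) \<xi>)"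
        unfolding fourier_iter_pd[OF g b order_refl]
        by (simp add: norm_mult norm_power inner_commute)
      also have "\<dots> \<le> ?S * I"
        by (rule F) (use b in \<open>auto simp: lists_eq_set set_replicate_conv_if\<close>)
      finally have "(1 + ?a ^ ?M) * cmod (fourier g \<xi>) \<le> 2 * (?S * I)"
        using 1 by (simp add: distrib_right)
      then show ?thesis by (simp only: mult.assoc mult_left_mono of_nat_0_le_iff)
    qed
    finally have "(1 + norm \<xi>) ^ ?M * cmod (fourier g \<xi>) \<le> (2 * DIM('a)) ^ ?M * (2 * (?S * I))" .
    moreover have "(1 + norm \<xi>) ^ ?M > 0" by (simp add: add_pos_nonneg)
    ultimately show ?thesis by (simp add: field_simps)
  qed
  then show thesis using I by (intro that[of "(2 * DIM('a)) ^ ?M * (2 * I)"]) auto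
qed

lemma integrable_schwartz:
  fixes g :: "'a::euclidean_space \<Rightarrow> complex"
  shows "schwartz g \<Longrightarrow> integrable lborel g"
  using integrable_iter_pd_schwartz[of g "[]"] by simp

lemma measurable_schwartz:
  fixes g :: "'a::euclidean_space \<Rightarrow> complex"
  shows "schwartz g \<Longrightarrow> g \<in> borel_measurable borel"
  using measurable_iter_pd_schwartz[of g "[]"] by simp

section \<open>Temperedness of the transform of an L^p function\<close>

text \<open>A substitute for Hoelder's inequality: it makes an L^p function integrable against any
  nonnegative weight that is both bounded and integrable.\<close>

lemma le_one_plus_powr:
  fixes x p :: real
  assumes "x \<ge> 0" "p \<ge> 1"
  shows "x \<le> 1 + x powr p"
proof (cases "x \<le> 1")
  case False
  then have "x powr 1 \<le> x powr p" using assms by (intro powr_mono) auto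
  then show ?thesis using False by simp
qed (simp add: add_increasing2)

text \<open>The functional sends \<open>g\<close> to the integral of \<open>f\<close> times
  \<open>fourier g\<close>. The decay estimate bounds this by a seminorm of \<open>g\<close> times
  the integral of |f| against the weight \<open>?w\<close>, which is finite since |f| * ?w \<le> ?w
  + |f|^p.\<close>

lemma tempered_fourier_dist:
  fixes f :: "'a::euclidean_space \<Rightarrow> complex"
  assumes f: "f \<in> borel_measurable lebesgue" and fp: "integrable lebesgue (\<lambda>x. cmod (f x) powr p)" and p: "p \<ge> 1"
  shows "tempered (fourier_dist (dist_of_fun f))"
proof -
  let ?M = "2 * DIM('a)"
  let ?w = "\<lambda>x::'a. inverse ((1 + norm x) ^ ?M)"
  obtain K where K: "K \<ge> 0" and decay: "\<And>g \<xi>. schwartz g \<Longrightarrow>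
    cmod (fourier g \<xi>) \<le> K * schwartz_norm ?M g * ?w \<xi>"
    using fourier_schwartz_decay by blast
  have wm: "?w \<in> borel_measurable borel" by measurable
  then have wm': "?w \<in> borel_measurable lebesgue" by (intro measurable_completion) simp
  have w_int: "integrable lebesgue ?w"
    using integrable_inverse_power_norm wm by (simp add: integrable_completion)
  have w_bounds: "0 \<le> ?w x" "?w x \<le> 1" for x :: 'a
    by (auto simp: inverse_le_1_iff one_le_power)
  have W: "integrable lebesgue (\<lambda>x. cmod (f x) * ?w x)"
  proof (rule Bochner_Integration.integrable_bound)
    show "integrable lebesgue (\<lambda>x. ?w x + cmod (f x) powr p)"
      using w_int fp by (rule Bochner_Integration.integrable_add)
    show "AE x in lebesgue. norm (cmod (f x) * ?w x) \<le> norm (?w x + cmod (f x) powr p)"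
    proof (rule AE_I2)
      fix x
      have "cmod (f x) * ?w x \<le> (1 + cmod (f x) powr p) * ?w x"
        using w_bounds p by (intro mult_right_mono le_one_plus_powr) auto
      also have "\<dots> \<le> ?w x + cmod (f x) powr p"
        using w_bounds[of x] mult_left_le[of "?w x" "cmod (f x) powr p"] by (simp add: distrib_right)
      finally show "norm (cmod (f x) * ?w x) \<le> norm (?w x + cmod (f x) powr p)"
        using w_bounds[of x] by (simp add: abs_mult del: inverse_nonnegative_iff_nonnegative)
    qed
    show "(\<lambda>x. cmod (f x) * ?w x) \<in> borel_measurable lebesgue"
      by (rule borel_measurable_times[OF measurable_compose[OF f borel_measurable_norm] wm'])
  qed
  have Fm: "fourier g \<in> borel_measurable lebesgue" if "schwartz g" for g :: "'a \<Rightarrow> complex"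
    using measurable_fourier[OF measurable_schwartz[OF that]] by (intro measurable_completion) simp
  have le: "cmod (f x * fourier g x) \<le> K * schwartz_norm ?M g * (cmod (f x) * ?w x)"
    if "schwartz g" for g :: "'a \<Rightarrow> complex" and x
    using mult_left_mono[OF decay[OF that, of x] norm_ge_zero[of "f x"]] by (simp add: norm_mult mult_ac)
  have int: "integrable lebesgue (\<lambda>x. f x * fourier g x)" if "schwartz g" for g :: "'a \<Rightarrow> complex"
  proof (rule Bochner_Integration.integrable_bound)
    show "integrable lebesgue (\<lambda>x. K * schwartz_norm ?M g * (cmod (f x) * ?w x))"
      using W by (rule integrable_mult_right)
    show "(\<lambda>x. f x * fourier g x) \<in> borel_measurable lebesgue"
      using f Fm[OF that] by (rule borel_measurable_times)
  qed (use le[OF that] in \<open>auto intro: order_trans[OF _ abs_ge_self]\<close>)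
  have add: "fourier_dist (dist_of_fun f) (\<lambda>x. g x + h x) = fourier_dist (dist_of_fun f) g + fourier_dist (dist_of_fun f) h"
    if g: "schwartz g" and h: "schwartz h" for g h :: "'a \<Rightarrow> complex"
  proof -
    have [measurable]: "g \<in> borel_measurable borel" "h \<in> borel_measurable borel"
      using g h measurable_schwartz by auto
    have "fourier (\<lambda>x. g x + h x) = (\<lambda>\<xi>. fourier g \<xi> + fourier h \<xi>)"
      using integrable_mult_character[OF integrable_schwartz[OF g]] integrable_mult_character[OF integrable_schwartz[OF h]]
      by (simp add: fun_eq_iff fourier_lborel distrib_right)
    then show ?thesis
      using int[OF g] int[OF h] by (simp add: fourier_dist_def dist_of_fun_def distrib_left)
  qed
  have scale: "fourier_dist (dist_of_fun f) (\<lambda>x. c * g x) = c * fourier_dist (dist_of_fun f) g"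
    if g: "schwartz g" for g :: "'a \<Rightarrow> complex" and c
  proof -
    have "fourier (\<lambda>x. c * g x) = (\<lambda>\<xi>. c * fourier g \<xi>)"
      by (simp add: fun_eq_iff fourier_def mult.assoc)
    then show ?thesis by (simp add: fourier_dist_def dist_of_fun_def mult.left_commute)
  qed
  have "cmod (fourier_dist (dist_of_fun f) g) \<le> K * (LINT x|lebesgue. cmod (f x) * ?w x) * schwartz_norm ?M g"
    if g: "schwartz g" for g
  proof -
    have "cmod (fourier_dist (dist_of_fun f) g) \<le> (LINT x|lebesgue. cmod (f x * fourier g x))"
      unfolding fourier_dist_def dist_of_fun_def by (rule integral_norm_bound)
    also have "\<dots> \<le> (LINT x|lebesgue. K * schwartz_norm ?M g * (cmod (f x) * ?w x))"
      by (intro integral_mono integrable_norm int g le integrable_mult_right W)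
    finally show ?thesis
      unfolding integral_mult_right_zero by (simp only: mult_ac)
  qed
  with add scale show ?thesis unfolding tempered_def by blast
qed

section \<open>Littlewood-Paley pieces\<close>

lemma integral_lborel_reflect:
  fixes f :: "'a::euclidean_space \<Rightarrow> 'b::{banach, second_countable_topology}"
  assumes [measurable]: "f \<in> borel_measurable borel"
  shows "(LINT x|lborel. f (c - x)) = integral\<^sup>L lborel f"
proof -
  have "lborel = distr lborel borel (\<lambda>x::'a. c - x)"
    using lborel_affine[of "-1" c] by (simp add: density_1)
  then have "integral\<^sup>L lborel f = integral\<^sup>L (distr lborel borel (\<lambda>x::'a. c - x)) f"
    by simp
  then show ?thesis by (simp add: integral_distr)
qed

text \<open>The transform of y \<mapsto> \<theta> (x - y) is a character times
  \<open>fourier \<theta> (- \<xi>)\<close>, and evenness removes the sign. Both sides are then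
  literally the same integral over \<xi>, without any exchange of integrations.\<close>

lemma conv_dist_fourier_dist:
  fixes f :: "'a::euclidean_space \<Rightarrow> complex"
  assumes \<theta>[measurable]: "\<theta> \<in> borel_measurable borel" and even: "\<And>\<xi>. fourier \<theta> (- \<xi>) = fourier \<theta> \<xi>"
  shows "conv_dist \<theta> (fourier_dist (dist_of_fun f)) = fourier (\<lambda>\<xi>. f \<xi> * fourier \<theta> \<xi>)"
proof
  fix x
  have "fourier (\<lambda>y. \<theta> (x - y)) \<xi> = character x \<xi> * fourier \<theta> \<xi>" for \<xi>
  proof -
    have shift: "character y \<xi> = character x \<xi> * character (x - y) (- \<xi>)" for y
      by (simp add: character_def inner_diff_left algebra_simps flip: exp_add)
    have "fourier (\<lambda>y. \<theta> (x - y)) \<xi> = (LINT y|lborel. character x \<xi> * (\<theta> (x - y) * character (x - y) (- \<xi>)))"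
      by (subst fourier_lborel, simp) (intro Bochner_Integration.integral_cong refl, subst shift, simp only: mult_ac)
    also have "\<dots> = character x \<xi> * (LINT y|lborel. \<theta> (x - y) * character (x - y) (- \<xi>))"
      by (rule integral_mult_right_zero)
    also have "(LINT y|lborel. \<theta> (x - y) * character (x - y) (- \<xi>)) = fourier \<theta> (- \<xi>)"
      using integral_lborel_reflect[of "\<lambda>y. \<theta> y * character y (- \<xi>)"] by (simp add: fourier_lborel)
    finally show ?thesis by (simp add: even)
  qed
  then have "conv_dist \<theta> (fourier_dist (dist_of_fun f)) x = (LINT \<xi>|lebesgue. (f \<xi> * fourier \<theta> \<xi>) * character \<xi> x)"
    unfolding conv_dist_def fourier_dist_def dist_of_fun_def
    by (simp add: character_commute[of x] mult_ac)
  then show "conv_dist \<theta> (fourier_dist (dist_of_fun f)) x = fourier (\<lambda>\<xi>. f \<xi> * fourier \<theta> \<xi>) x"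
    unfolding fourier_def[of _ x] character_def .
qed

text \<open>Bounded support of \<open>m\<close> makes f * m integrable, as Hausdorff-Young requires;
  \<open>R\<close> does not enter the bound. The multiplier appears to the first power on the right
  so that a sum over scales can telescope.\<close>

lemma ennpowr_Lp_norm_conv_dist_le:
  fixes f :: "'a::euclidean_space \<Rightarrow> complex"
  assumes HY: "\<And>g::'a \<Rightarrow> complex. integrable lebesgue g \<Longrightarrow>
      ennpowr (Lp_norm p' (fourier g)) p \<le> ennreal C * (\<integral>\<^sup>+x. ennreal (cmod (g x) powr p) \<partial>lebesgue)"
    and f: "f \<in> borel_measurable lebesgue" and fp: "integrable lebesgue (\<lambda>x. cmod (f x) powr p)" and p: "p \<ge> 1"
    and \<theta>: "schwartz \<theta>" and m: "\<And>\<xi>. fourier \<theta> \<xi> = of_real (m \<xi>)"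
    and even: "\<And>\<xi>. m (- \<xi>) = m \<xi>" and m01: "\<And>\<xi>. 0 \<le> m \<xi>" "\<And>\<xi>. m \<xi> \<le> 1"
    and supp: "\<And>\<xi>. norm \<xi> \<ge> R \<Longrightarrow> m \<xi> = 0"
  shows "ennpowr (Lp_norm p' (conv_dist \<theta> (fourier_dist (dist_of_fun f)))) p
    \<le> ennreal C * (\<integral>\<^sup>+x. ennreal (m x * cmod (f x) powr p) \<partial>lebesgue)"
proof -
  have "(\<lambda>\<xi>. Re (fourier \<theta> \<xi>)) \<in> borel_measurable borel"
    using measurable_schwartz[OF \<theta>] by measurable
  then have m_m: "(\<lambda>\<xi>. complex_of_real (m \<xi>)) \<in> borel_measurable lebesgue"
    unfolding m by (intro measurable_completion) simp
  have ball: "integrable lebesgue (indicat_real (ball 0 R :: 'a set))"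
    using emeasure_bounded_finite[of "ball 0 R :: 'a set"]
    by (intro integrable_real_indicator) auto
  have int: "integrable lebesgue (\<lambda>\<xi>. f \<xi> * of_real (m \<xi>))"
  proof (rule Bochner_Integration.integrable_bound)
    show "integrable lebesgue (\<lambda>x. indicat_real (ball 0 R) x + cmod (f x) powr p)"
      using ball fp by (rule Bochner_Integration.integrable_add)
    show "AE x in lebesgue. cmod (f x * of_real (m x)) \<le> norm (indicat_real (ball 0 R) x + cmod (f x) powr p)"
    proof (rule AE_I2)
      fix x
      have "cmod (f x) * m x \<le> indicat_real (ball 0 R) x + cmod (f x) powr p"
      proof (cases "norm x < R")
        case True
        have "cmod (f x) * m x \<le> cmod (f x)" using m01[of x] by (simp add: mult_left_le)
        also have "\<dots> \<le> 1 + cmod (f x) powr p" using p by (intro le_one_plus_powr) auto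
        finally show ?thesis using True by simp
      qed (use supp[of x] in simp)
      then show "cmod (f x * of_real (m x)) \<le> norm (indicat_real (ball 0 R) x + cmod (f x) powr p)"
        using m01(1)[of x] by (simp add: norm_mult)
    qed
    show "(\<lambda>\<xi>. f \<xi> * of_real (m \<xi>)) \<in> borel_measurable lebesgue"
      using f m_m by (rule borel_measurable_times)
  qed
  have "ennpowr (Lp_norm p' (conv_dist \<theta> (fourier_dist (dist_of_fun f)))) p \<le>
      ennreal C * (\<integral>\<^sup>+x. ennreal (cmod (f x * of_real (m x)) powr p) \<partial>lebesgue)"
    using HY[OF int] conv_dist_fourier_dist[OF measurable_schwartz[OF \<theta>], of f] by (simp add: m even)
  also have "\<dots> \<le> ennreal C * (\<integral>\<^sup>+x. ennreal (m x * cmod (f x) powr p) \<partial>lebesgue)"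
  proof (intro mult_left_mono nn_integral_mono ennreal_leI)
    fix x
    \<comment> \<open>Raising a number in the unit interval to a power p \<ge> 1 does not increase
      it.\<close>
    have "m x powr p \<le> m x powr 1"
      using m01[of x] p by (intro powr_mono') auto
    then show "cmod (f x * of_real (m x)) powr p \<le> m x * cmod (f x) powr p"
      using m01(1)[of x] by (simp add: norm_mult powr_mult mult.commute[of "cmod (f x) powr p"] mult_right_mono)
  qed simp
  finally show ?thesis .
qed

section \<open>Summation over the dyadic scales\<close>

lemma infsum_ennreal_le:
  fixes T :: "'i \<Rightarrow> ennreal"
  assumes "\<And>F. finite F \<Longrightarrow> F \<subseteq> A \<Longrightarrow> sum T F \<le> B"
  shows "infsum T A \<le> B"
  using assms by (auto simp: nonneg_infsum_complete intro!: SUP_least)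

text \<open>Each piece becomes the difference of two consecutive dilates of one radial profile, the
  form that telescopes. The bounds 0 and 1 come from monotonicity together with \<rho> 0 = 1 and the
  vanishing from 2 on.\<close>

lemma littlewood_paley_profile:
  fixes \<phi> :: "'a::euclidean_space \<Rightarrow> complex"
  assumes "littlewood_paley \<phi> \<psi>"
  obtains \<rho> :: "real \<Rightarrow> real" where
    "\<And>\<xi>. fourier \<phi> \<xi> = of_real (\<rho> (norm \<xi>))"
    "\<And>k \<xi>. fourier (\<psi> k) \<xi> = of_real (\<rho> (2 powi (- (k + 1)) * norm \<xi>) - \<rho> (2 powi (- k) * norm \<xi>))"
    "\<And>t. 0 \<le> t \<Longrightarrow> 0 \<le> \<rho> t" "\<And>t. 0 \<le> t \<Longrightarrow> \<rho> t \<le> 1"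
    "\<And>t. 2 \<le> t \<Longrightarrow> \<rho> t = 0" "\<And>s t. 0 \<le> s \<Longrightarrow> s \<le> t \<Longrightarrow> \<rho> t \<le> \<rho> s"
proof -
  obtain \<rho> :: "real \<Rightarrow> real" where anti: "antimono_on {0..} \<rho>" and \<phi>: "\<And>\<xi>. fourier \<phi> \<xi> = of_real (\<rho> (norm \<xi>))"
    using assms unfolding littlewood_paley_def by blast
  have one: "\<And>\<xi>. norm \<xi> \<le> 1 \<Longrightarrow> fourier \<phi> \<xi> = 1" and zero: "\<And>\<xi>. norm \<xi> \<ge> 2 \<Longrightarrow> fourier \<phi> \<xi> = 0"
    and \<psi>0: "\<And>\<xi>. fourier (\<psi> 0) \<xi> = fourier \<phi> (\<xi> /\<^sub>R 2) - fourier \<phi> \<xi>"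
    and \<psi>k: "\<And>k \<xi>. fourier (\<psi> k) \<xi> = fourier (\<psi> 0) ((2 powi (- k)) *\<^sub>R \<xi>)"
    using assms unfolding littlewood_paley_def by blast+
  have le: "\<rho> t \<le> \<rho> s" if "0 \<le> s" "s \<le> t" for s t
    using anti that by (auto simp: monotone_on_def)
  have \<rho>0: "\<rho> t = 0" if "2 \<le> t" for t
    \<comment> \<open>The hypotheses speak of \<rho> only at norms of vectors; every t \<ge> 0 is
      such a norm.\<close>
    using zero \<phi> that vector_choose_size[of t] by (metis of_real_eq_0_iff order_trans zero_le_numeral)
  have "\<rho> 0 = 1"
    using one[of 0] \<phi>[of 0] by simp
  then have \<rho>_le: "\<rho> t \<le> 1" if "0 \<le> t" for t using le[of 0 t] that by simp
  have \<rho>_ge: "0 \<le> \<rho> t" if "0 \<le> t" for t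
    using le[of t "max 2 t"] \<rho>0[of "max 2 t"] that by simp
  have "fourier (\<psi> k) \<xi> = of_real (\<rho> (2 powi (- (k + 1)) * norm \<xi>) - \<rho> (2 powi (- k) * norm \<xi>))" for k \<xi>
  proof -
    have "(2::real) powi (- (k + 1)) = 2 powi (- k) / 2"
      by (simp add: power_int_diff)
    then have half: "norm (((2 powi (- k)) *\<^sub>R \<xi>) /\<^sub>R 2) = 2 powi (- (k + 1)) * norm \<xi>"
      and full: "norm ((2 powi (- k)) *\<^sub>R \<xi>) = 2 powi (- k) * norm \<xi>"
      by simp_all
    show ?thesis
      unfolding \<psi>k[of k \<xi>] \<psi>0 \<phi> of_real_diff half full ..
  qed
  with \<phi> \<rho>_ge \<rho>_le \<rho>0 le show thesis by (intro that)
qed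

text \<open>By monotonicity all terms are nonnegative, so \<open>F\<close> may be enlarged to a
  symmetric interval, where the sum collapses to a difference of two values in the unit
  interval.\<close>

lemma sum_int_telescope_le:
  fixes r :: "int \<Rightarrow> real"
  assumes mono: "\<And>i j. i \<le> j \<Longrightarrow> r i \<le> r j" and r01: "\<And>i. 0 \<le> r i" "\<And>i. r i \<le> 1"
    and F: "finite F"
  shows "(\<Sum>k\<in>F. r (k + 1) - r k) \<le> 1"
proof -
  obtain n :: nat where n: "\<And>k. k \<in> F \<Longrightarrow> \<bar>k\<bar> \<le> int n"
  proof -
    have "\<bar>k\<bar> \<le> int (nat (\<Sum>k\<in>F. \<bar>k\<bar>))" if "k \<in> F" for k
      using member_le_sum[of k F abs] that F by (simp add: sum_nonneg)
    then show thesis by (rule that)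
  qed
  \<comment> \<open>The upper end is written \<open>int N - int n\<close> to allow induction on a
    natural number; N = 2 * n gives the symmetric interval.\<close>
  have tel: "(\<Sum>k\<in>{- int n..int N - int n}. r (k + 1) - r k) = r (int N - int n + 1) - r (- int n)" for N :: nat
  proof (induction N)
    case (Suc N)
    have "{- int n..int (Suc N) - int n} = insert (int (Suc N) - int n) {- int n..int N - int n}" by auto
    then show ?case using Suc by (simp add: algebra_simps)
  qed simp
  have "(\<Sum>k\<in>F. r (k + 1) - r k) \<le> (\<Sum>k\<in>{- int n..int (2 * n) - int n}. r (k + 1) - r k)"
    using n mono by (intro sum_mono2) (auto simp: abs_le_iff minus_le_iff)
  also have "\<dots> \<le> 1"
    unfolding tel using r01 by (smt (verit))
  finally show ?thesis .
qed

theorem theorem1p14: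
  fixes \<phi> :: "real ^ 'n \<Rightarrow> complex"
    and \<psi> :: "int \<Rightarrow> real ^ 'n \<Rightarrow> complex"
    and p :: real and p' :: ennreal
  assumes "littlewood_paley \<phi> \<psi>"
    and "1 \<le> p" and "p \<le> 2"
    and "1 / ennreal p + 1 / p' = 1"
  shows "\<exists>C::real. C > 0 \<and>
    (\<forall>f \<in> Lp_functions (ennreal p).
       fourier_dist (dist_of_fun f) \<in> besov_space \<phi> \<psi> p' p 0 \<and>
       poly_class (fourier_dist (dist_of_fun f)) \<in> hom_besov_space \<psi> p' p 0 \<and>
       hom_besov_norm \<psi> p' p 0 (fourier_dist (dist_of_fun f)) +
         besov_norm \<phi> \<psi> p' p 0 (fourier_dist (dist_of_fun f))
       \<le> ennreal C * Lp_norm (ennreal p) f)"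
proof -
  obtain C :: real where C: "C > 0" and HY: "\<And>g::real ^ 'n \<Rightarrow> complex. integrable lebesgue g \<Longrightarrow>
      ennpowr (Lp_norm p' (fourier g)) p \<le> ennreal C * (\<integral>\<^sup>+x. ennreal (cmod (g x) powr p) \<partial>lebesgue)"
    using hausdorff_young[OF assms(2-4)] by blast
  obtain \<rho> :: "real \<Rightarrow> real" where \<phi>: "\<And>\<xi>. fourier \<phi> \<xi> = of_real (\<rho> (norm \<xi>))"
    and \<psi>: "\<And>k \<xi>. fourier (\<psi> k) \<xi> = of_real (\<rho> (2 powi (- (k + 1)) * norm \<xi>) - \<rho> (2 powi (- k) * norm \<xi>))"
    and \<rho>_nonneg: "\<And>t. 0 \<le> t \<Longrightarrow> 0 \<le> \<rho> t" and \<rho>_le: "\<And>t. 0 \<le> t \<Longrightarrow> \<rho> t \<le> 1"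
    and \<rho>0: "\<And>t. 2 \<le> t \<Longrightarrow> \<rho> t = 0" and anti: "\<And>s t. 0 \<le> s \<Longrightarrow> s \<le> t \<Longrightarrow> \<rho> t \<le> \<rho> s"
    using littlewood_paley_profile[OF assms(1)] by blast
  have schwartz: "schwartz \<phi>" "schwartz (\<psi> k)" for k
    using assms(1) by (auto simp: littlewood_paley_def)
  define r where "r \<xi> k = \<rho> (2 powi (- k) * norm \<xi>)" for \<xi> :: "real ^ 'n" and k :: int
  define m where "m k \<xi> = r \<xi> (k + 1) - r \<xi> k" for k and \<xi> :: "real ^ 'n"
  \<comment> \<open>The factor 2 powi (- k) decreases in k and \<rho> is antitone, so the dilates
    increase with k.\<close>
  have r_mono: "r \<xi> i \<le> r \<xi> j" if "i \<le> j" for \<xi> i j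
    unfolding r_def using that by (intro anti mult_right_mono power_int_increasing) auto
  have r01: "0 \<le> r \<xi> k" "r \<xi> k \<le> 1" for \<xi> k
    unfolding r_def by (auto intro!: \<rho>_nonneg \<rho>_le)
  have m01: "0 \<le> m k \<xi>" "m k \<xi> \<le> 1" for k \<xi>
    using r_mono[of k "k + 1" \<xi>] r01[of \<xi>] by (auto simp: m_def) (smt (verit))
  \<comment> \<open>From this radius on the larger of the two dilates vanishes, and with it the
    smaller, which lies between 0 and the larger.\<close>
  have m_supp: "m k \<xi> = 0" if "norm \<xi> \<ge> 2 / 2 powi (- (k + 1))" for k \<xi>
  proof -
    have "2 powi (- (k + 1)) * norm \<xi> \<ge> 2"
      using that by (simp add: divide_le_eq mult.commute)
    then have "r \<xi> (k + 1) = 0" unfolding r_def by (rule \<rho>0)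
    then show ?thesis using r_mono[of k "k + 1" \<xi>] r01[of \<xi> k] by (simp add: m_def)
  qed
  have m_sum: "(\<Sum>k\<in>F. m k \<xi>) \<le> 1" if "finite F" for F \<xi>
    unfolding m_def by (rule sum_int_telescope_le) (use r_mono r01 that in auto)
  have \<psi>_m: "fourier (\<psi> k) \<xi> = of_real (m k \<xi>)" for k \<xi>
    by (simp only: \<psi> m_def r_def)
  have m_even: "m k (- \<xi>) = m k \<xi>" for k \<xi>
    by (simp add: m_def r_def)
  \<comment> \<open>The first term bounds the homogeneous norm. The second bounds the inhomogeneous
    one, whose low-frequency part and sum each contribute at most C * B before the root is
    taken.\<close>
  define K where "K = C powr (1 / p) + (2 * C) powr (1 / p)"
  have main: "tempered u \<and> hom_besov_norm \<psi> p' p 0 u < \<infinity> \<and> besov_norm \<phi> \<psi> p' p 0 u < \<infinity> \<and>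
      hom_besov_norm \<psi> p' p 0 u + besov_norm \<phi> \<psi> p' p 0 u \<le> ennreal K * Lp_norm (ennreal p) f"
    if f: "f \<in> Lp_functions (ennreal p)" and u: "u = fourier_dist (dist_of_fun f)" for f u
  proof -
    have f_m: "f \<in> borel_measurable lebesgue" using f by (simp add: Lp_functions_def)
    define B where "B = (\<integral>\<^sup>+x. ennreal (cmod (f x) powr p) \<partial>lebesgue)"
    have norm_f: "Lp_norm (ennreal p) f = ennpowr B (1 / p)"
      using assms(2) by (simp add: Lp_norm_def B_def)
    then have "B < \<infinity>"
      using f by (auto simp: Lp_functions_def ennpowr_def less_top split: if_splits)
    then obtain A where A: "B = ennreal A" "A \<ge> 0" by (cases B) auto
    have fp_m: "(\<lambda>x. cmod (f x) powr p) \<in> borel_measurable lebesgue"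
      by (rule measurable_compose[OF f_m]) measurable
    have fp: "integrable lebesgue (\<lambda>x. cmod (f x) powr p)"
      using \<open>B < \<infinity>\<close> fp_m by (intro integrableI_bounded) (auto simp: B_def)
    have \<phi>_le: "ennpowr (Lp_norm p' (conv_dist \<phi> u)) p \<le> ennreal C * B"
    proof -
      have "ennpowr (Lp_norm p' (conv_dist \<phi> u)) p \<le> ennreal C * (\<integral>\<^sup>+x. ennreal (\<rho> (norm x) * cmod (f x) powr p) \<partial>lebesgue)"
        unfolding u
        by (rule ennpowr_Lp_norm_conv_dist_le[OF HY f_m fp assms(2) schwartz(1) \<phi>]) (auto intro: \<rho>_nonneg \<rho>_le \<rho>0)
      also have "\<dots> \<le> ennreal C * B"
        unfolding B_def by (intro mult_left_mono nn_integral_mono ennreal_leI mult_left_le_one_le \<rho>_nonneg \<rho>_le) auto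
      finally show ?thesis .
    qed
    \<comment> \<open>Finite sets of scales suffice for the infinite sum, provided the bound is
      uniform in \<open>F\<close>. It is, because the sum goes inside the integral, where the
      multipliers add up to at most 1.\<close>
    have \<psi>_le: "(\<Sum>k\<in>F. ennpowr (Lp_norm p' (conv_dist (\<psi> k) u)) p) \<le> ennreal C * B" if F: "finite F" for F
    proof -
      have m_m: "(\<lambda>x. m k x) \<in> borel_measurable lebesgue" for k
      proof (rule measurable_completion)
        have "(\<lambda>x. Re (fourier (\<psi> k) x)) \<in> borel_measurable borel"
          using measurable_schwartz[OF schwartz(2)] by measurable
        then show "m k \<in> borel_measurable lborel" by (simp add: \<psi>_m)
      qed
      have "(\<Sum>k\<in>F. ennpowr (Lp_norm p' (conv_dist (\<psi> k) u)) p) \<le>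
          (\<Sum>k\<in>F. ennreal C * (\<integral>\<^sup>+x. ennreal (m k x * cmod (f x) powr p) \<partial>lebesgue))"
        unfolding u
        by (rule sum_mono, rule ennpowr_Lp_norm_conv_dist_le[OF HY f_m fp assms(2) schwartz(2) \<psi>_m m_even m01 m_supp])
      also have "\<dots> = ennreal C * (\<integral>\<^sup>+x. (\<Sum>k\<in>F. ennreal (m k x * cmod (f x) powr p)) \<partial>lebesgue)"
        unfolding sum_distrib_left[symmetric]
        by (subst nn_integral_sum) (auto intro!: borel_measurable_times m_m fp_m measurable_compose[OF _ measurable_ennreal])
      also have "\<dots> \<le> ennreal C * B"
        unfolding B_def
      proof (intro mult_left_mono nn_integral_mono)
        fix x
        have "(\<Sum>k\<in>F. m k x) * cmod (f x) powr p \<le> 1 * cmod (f x) powr p"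
          using m_sum[OF F] by (intro mult_right_mono) auto
        then show "(\<Sum>k\<in>F. ennreal (m k x * cmod (f x) powr p)) \<le> ennreal (cmod (f x) powr p)"
          by (simp add: sum_ennreal m01 sum_distrib_right ennreal_leI)
      qed simp
      finally show ?thesis .
    qed
    \<comment> \<open>\<open>B\<close> is the p-th power of the L^p norm, so taking the p-th root
      restores linearity in the norm of \<open>f\<close>.\<close>
    have pow: "ennpowr (ennreal c * B) (1 / p) = ennreal (c powr (1 / p)) * Lp_norm (ennreal p) f" if "c \<ge> 0" for c
      using that A by (simp add: norm_f ennpowr_ennreal powr_mult flip: ennreal_mult)
    have "(\<Sum>\<^sub>\<infinity>k::int. ennreal (2 powr (of_int k * 0 * p)) * ennpowr (Lp_norm p' (conv_dist (\<psi> k) u)) p) \<le> ennreal C * B"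
      by (rule infsum_ennreal_le) (simp add: \<psi>_le)
    then have "hom_besov_norm \<psi> p' p 0 u \<le> ennpowr (ennreal C * B) (1 / p)"
      unfolding hom_besov_norm_def using assms(2) by (intro ennpowr_mono) auto
    also have "\<dots> = ennreal (C powr (1 / p)) * Lp_norm (ennreal p) f"
      using C by (intro pow) simp
    finally have hom: "hom_besov_norm \<psi> p' p 0 u \<le> ennreal (C powr (1 / p)) * Lp_norm (ennreal p) f" .
    have "(\<Sum>\<^sub>\<infinity>k::nat. ennreal (2 powr (real k * 0 * p)) * ennpowr (Lp_norm p' (conv_dist (\<psi> (int k)) u)) p) \<le> ennreal C * B"
    proof (rule infsum_ennreal_le)
      fix F :: "nat set" assume "finite F"
      \<comment> \<open>The nonnegative scales are among the integer ones, so the same uniform bound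
        serves both norms; at smoothness 0 the dyadic weights are 1.\<close>
      then have "(\<Sum>k\<in>int ` F. ennpowr (Lp_norm p' (conv_dist (\<psi> k) u)) p) \<le> ennreal C * B"
        by (intro \<psi>_le) simp
      then show "(\<Sum>k\<in>F. ennreal (2 powr (real k * 0 * p)) * ennpowr (Lp_norm p' (conv_dist (\<psi> (int k)) u)) p) \<le> ennreal C * B"
        by (simp add: sum.reindex)
    qed
    with \<phi>_le have "besov_norm \<phi> \<psi> p' p 0 u \<le> ennpowr (ennreal C * B + ennreal C * B) (1 / p)"
      unfolding besov_norm_def using assms(2) by (intro ennpowr_mono add_mono) auto
    also have "ennreal C * B + ennreal C * B = ennreal (2 * C) * B"
      using C A by (simp flip: ennreal_mult ennreal_plus)
    also have "ennpowr (ennreal (2 * C) * B) (1 / p) = ennreal ((2 * C) powr (1 / p)) * Lp_norm (ennreal p) f"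
      using C by (intro pow) simp
    finally have inhom: "besov_norm \<phi> \<psi> p' p 0 u \<le> ennreal ((2 * C) powr (1 / p)) * Lp_norm (ennreal p) f" .
    have fin: "ennreal c * Lp_norm (ennreal p) f < \<infinity>" for c
      using f by (auto simp: Lp_functions_def ennreal_mult_less_top)
    have "hom_besov_norm \<psi> p' p 0 u + besov_norm \<phi> \<psi> p' p 0 u \<le> ennreal K * Lp_norm (ennreal p) f"
      using add_mono[OF hom inhom] by (simp add: K_def distrib_right)
    moreover have "tempered u"
      unfolding u using f_m fp assms(2) by (rule tempered_fourier_dist)
    ultimately show ?thesis
      using order.strict_trans1[OF hom fin] order.strict_trans1[OF inhom fin] by blast
  qed
  have "K > 0" using C by (simp add: K_def add_pos_pos)
  \<comment> \<open>Membership of the class in the homogeneous space is witnessed by the transform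
    of \<open>f\<close> itself as representative.\<close>
  with main show ?thesis
    unfolding besov_space_def hom_besov_space_def by (intro exI[of _ K]) blast
qed

end
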